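(* Let $C:[0,1]\to\mathbb{R}$ be continuously differentiable and suppose that the function $t\mapsto tC'(t)$ is strictly increasing on $[0,1]$. Put $c(x,y,z)=C(xyz)$ for $(x,y,z)\in[0,1]^3$ and $$\hat f(s)=\int_0^s\lambda(t)\,C'(t\lambda(t))\,dt,\qquad s\in[0,1].$$ Then for any real constants $C_x,C_y,C_z$ with $$C_x+C_y+C_z=C(0)-2\int_0^1\lambda(t)\,C'(t\lambda(t))\,dt$$ one has $$(\hat f(x)+C_x)+(\hat f(y)+C_y)+(\hat f(z)+C_z)\le c(x,y,z)\quad\text{for all }(x,y,z)\in[0,1]^3,$$ with equality for all $(x,y,z)\in M$. Consequently, every $(3,1)$-stochastic measure $\pi$ with $\operatorname{supp}(\pi)\subset M$ is a primal solution for the cost $c$, and the triple $(\hat f+C_x,\hat f+C_y,\hat f+C_z)$ is a dual solution for the cost $c$.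
   Context: Constants: $l\approx 0.0945$ is the unique root in $(0,1/4)$ of the equation $9t+\ln(1-2t)-\ln t-3=0$, and $r=1-2l$. The set $M\subset[0,1]^3$ is $M=M_x\cup M_y\cup M_z\cup M_2$, where $M_x=\{(t,1-2t,1-2t): 0\le t\le l\}$, $M_y=\{(1-2t,t,1-2t): 0\le t\le l\}$, $M_z=\{(1-2t,1-2t,t): 0\le t\le l\}$, $M_2=\{(x,y,z): l\le x,y,z\le r,\ xyz=lr^2\}$. The function $\lambda:[0,1]\to\mathbb{R}$ is $\lambda(x)=(1-2x)^2$ for $x\in[0,l)$, $\lambda(x)=lr^2/x$ for $x\in[l,r)$, $\lambda(x)=\tfrac12x(1-x)$ for $x\in[r,1]$. A $(3,1)$-stochastic measure is a Borel probability measure on $[0,1]^3$ whose three one-dimensional marginals are all Lebesgue measure on $[0,1]$. A primal solution for the cost $c$ is a $(3,1)$-stochastic measure minimizing $\int c\,d\mu$ over all $(3,1)$-stochastic measures $\mu$. A dual solution for $c$ is a triple of Lebesgue integrable functions $f,g,h:[0,1]\to\mathbb{R}$ with $f(x)+g(y)+h(z)\le c(x,y,z)$ for all $x,y,z\in[0,1]$ that maximizes $\int_0^1 f+\int_0^1 g+\int_0^1 h$ among all such triples. *)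

theory Defs
  imports "HOL-Probability.Probability"
begin

definition l_const :: real where
  "l_const = (THE t. 0 < t \<and> t < 1/4 \<and> 9 * t + ln (1 - 2 * t) - ln t - 3 = 0)"

definition r_const :: real where
  "r_const = 1 - 2 * l_const"

abbreviation unit_cube :: "(real \<times> real \<times> real) set" where
  "unit_cube \<equiv> {0..1} \<times> {0..1} \<times> {0..1}"

definition M_x :: "(real \<times> real \<times> real) set" where
  "M_x = {(t, 1 - 2 * t, 1 - 2 * t) | t. 0 \<le> t \<and> t \<le> l_const}"

definition M_y :: "(real \<times> real \<times> real) set" where
  "M_y = {(1 - 2 * t, t, 1 - 2 * t) | t. 0 \<le> t \<and> t \<le> l_const}"

definition M_z :: "(real \<times> real \<times> real) set" where
  "M_z = {(1 - 2 * t, 1 - 2 * t, t) | t. 0 \<le> t \<and> t \<le> l_const}"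

definition M_2 :: "(real \<times> real \<times> real) set" where
  "M_2 = {(x, y, z). x \<in> {l_const..r_const} \<and> y \<in> {l_const..r_const} \<and> z \<in> {l_const..r_const}
            \<and> x * y * z = l_const * r_const\<^sup>2}"

definition M_set :: "(real \<times> real \<times> real) set" where
  "M_set = M_x \<union> M_y \<union> M_z \<union> M_2"

text \<open>Functions on the unit interval or the unit cube are total functions here;
  their values outside that domain are never used.\<close>

definition lam :: "real \<Rightarrow> real" where
  "lam x = (if x < l_const then (1 - 2 * x)\<^sup>2
            else if x < r_const then l_const * r_const\<^sup>2 / x
            else 1/2 * x * (1 - x))"

definition product_cost :: "(real \<Rightarrow> real) \<Rightarrow> real \<times> real \<times> real \<Rightarrow> real" where
  "product_cost C = (\<lambda>(x, y, z). C (x * y * z))"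

text \<open>The argument \<open>C'\<close> stands for the derivative of \<open>C\<close> on the unit interval
  (one-sided at the endpoints).\<close>

definition fhat :: "(real \<Rightarrow> real) \<Rightarrow> real \<Rightarrow> real" where
  "fhat C' s = integral {0..s} (\<lambda>t. lam t * C' (t * lam t))"

definition stochastic_3_1 :: "(real \<times> real \<times> real) measure \<Rightarrow> bool" where
  "stochastic_3_1 \<mu> \<longleftrightarrow>
     prob_space \<mu> \<and> sets \<mu> = sets (restrict_space borel unit_cube) \<and>
     (let I = restrict_space lborel {0..1::real} in
        distr \<mu> I (\<lambda>(x, y, z). x) = I \<and>
        distr \<mu> I (\<lambda>(x, y, z). y) = I \<and>
        distr \<mu> I (\<lambda>(x, y, z). z) = I)"

definition measure_support :: "'a::topological_space measure \<Rightarrow> 'a set" where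
  "measure_support \<mu> =
     {p \<in> space \<mu>. \<forall>U. open U \<and> p \<in> U \<longrightarrow> emeasure \<mu> (U \<inter> space \<mu>) > 0}"

text \<open>The integrability requirement makes the minimization problem meaningful, since the
  Bochner integral of a non-integrable function is 0 by convention. It holds automatically
  for costs that are continuous on the cube.\<close>

definition primal_solution ::
  "(real \<times> real \<times> real \<Rightarrow> real) \<Rightarrow> (real \<times> real \<times> real) measure \<Rightarrow> bool" where
  "primal_solution c \<mu> \<longleftrightarrow>
     stochastic_3_1 \<mu> \<and>
     (\<forall>\<nu>. stochastic_3_1 \<nu> \<longrightarrow>
        integrable \<nu> c \<and> (\<integral>p. c p \<partial>\<mu>) \<le> (\<integral>p. c p \<partial>\<nu>))"

definition dual_feasible ::
  "(real \<times> real \<times> real \<Rightarrow> real) \<Rightarrow> (real \<Rightarrow> real) \<Rightarrow> (real \<Rightarrow> real) \<Rightarrow> (real \<Rightarrow> real) \<Rightarrow> bool" where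
  "dual_feasible c f g h \<longleftrightarrow>
     integrable (lebesgue_on {0..1}) f \<and>
     integrable (lebesgue_on {0..1}) g \<and>
     integrable (lebesgue_on {0..1}) h \<and>
     (\<forall>x\<in>{0..1}. \<forall>y\<in>{0..1}. \<forall>z\<in>{0..1}. f x + g y + h z \<le> c (x, y, z))"

definition dual_value :: "(real \<Rightarrow> real) \<Rightarrow> (real \<Rightarrow> real) \<Rightarrow> (real \<Rightarrow> real) \<Rightarrow> real" where
  "dual_value f g h =
     integral\<^sup>L (lebesgue_on {0..1}) f + integral\<^sup>L (lebesgue_on {0..1}) g
       + integral\<^sup>L (lebesgue_on {0..1}) h"

definition dual_solution ::
  "(real \<times> real \<times> real \<Rightarrow> real) \<Rightarrow> (real \<Rightarrow> real) \<Rightarrow> (real \<Rightarrow> real) \<Rightarrow> (real \<Rightarrow> real) \<Rightarrow> bool" where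
  "dual_solution c f g h \<longleftrightarrow>
     dual_feasible c f g h \<and>
     (\<forall>f' g' h'. dual_feasible c f' g' h' \<longrightarrow> dual_value f' g' h' \<le> dual_value f g h)"

end

theory Submission
  imports Defs
begin

text \<open>
  The gap \<open>C(xyz) - f(x) - f(y) - f(z)\<close>, where \<open>f\<close> is \<open>fhat C'\<close>, attains its minimum over the cube.
  In the variable \<open>z\<close> alone it is strictly minimal where \<open>xy = \<lambda>(z)\<close>, because \<open>t C'(t)\<close> is strictly
  increasing and \<open>\<lambda>\<close> is strictly decreasing. A global minimiser therefore satisfies
  \<open>xy = \<lambda>(z)\<close>, \<open>yz = \<lambda>(x)\<close>, \<open>xz = \<lambda>(y)\<close>, which forces it into \<open>M\<close>, and the gap is constant on \<open>M\<close>.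

  Optimality of the dual triple does not follow from weak duality alone, since this needs a
  \<open>(3,1)\<close>-stochastic measure on \<open>M\<close>. Instead it is shown directly that a continuous \<open>S\<close> with
  \<open>S(x) + S(y) + S(z) \<le> 0\<close> on \<open>M\<close> has \<open>\<integral> S \<le> 0\<close>. The curves handle \<open>[0,l]\<close> and \<open>[r,1]\<close>. On \<open>[l,r]\<close>,
  with \<open>\<sigma>(a) = S(r e\<^sup>-\<^sup>k\<^sup>a)\<close> and \<open>k = ln (r/l) = 3 - 9l\<close>, the claim becomes \<open>\<integral> \<sigma>(a) e\<^sup>-\<^sup>k\<^sup>a da \<le> 0\<close> over \<open>[0,1]\<close>
  whenever \<open>\<sigma>(a) + \<sigma>(b) + \<sigma>(c) \<le> 0\<close> for \<open>a + b + c = 1\<close>. The equation defining \<open>l\<close> says that the density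
  \<open>e\<^sup>-\<^sup>k\<^sup>a\<close> has mean 1/3, and the claim follows by averaging the hypothesis over suitable segments of
  the simplex, using only \<open>k \<ge> 2\<close>.
\<close>

section \<open>The constants and the function lambda\<close>

text \<open>The derivative -(6t-1)(3t-1)/(t(1-2t)) makes the left-hand side decrease up to 1/6 and
  increase from there to 1/4. It is negative at 1/9 and at 1/4, so the only root lies below 1/9.
  This bound later gives \<open>7/9 < r_const\<close> and k \<ge> 2.\<close>

lemma l_equation_solution:
  "\<exists>t. 0 < t \<and> t < 1/9 \<and> 9 * t + ln (1 - 2 * t) - ln t - 3 = 0
     \<and> (\<forall>s. 0 < s \<and> s < 1/4 \<and> 9 * s + ln (1 - 2 * s) - ln s - 3 = 0 \<longrightarrow> s = (t::real))"
proof -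
  define \<phi> where "\<phi> = (\<lambda>t::real. 9 * t + ln (1 - 2 * t) - ln t - 3)"
  have der: "(\<phi> has_real_derivative - ((6*t-1)*(3*t-1)/(t*(1-2*t)))) (at t)" if "0 < t" "t < 1/2" for t
  proof -
    have "(\<phi> has_real_derivative 9 + (-2) / (1 - 2 * t) - 1 / t) (at t)"
      unfolding \<phi>_def by (rule derivative_eq_intros refl | use that in force)+
    moreover have "9 + (-2) / (1 - 2 * t) - 1 / t = - ((6*t-1)*(3*t-1)/(t*(1-2*t)))"
      using that by (simp add: divide_simps) (simp add: algebra_simps)
    ultimately show ?thesis by simp
  qed
  have cont: "continuous_on {a..b} \<phi>" if "0 < a" "b < 1/2" for a b
    using that by (intro continuous_at_imp_continuous_on ballI DERIV_isCont[OF der]) auto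
  have dec: "\<phi> b < \<phi> a" if "0 < a" "a < b" "b \<le> 1/6" for a b
  proof (rule DERIV_neg_imp_decreasing_open[OF that(2)])
    fix x assume x: "a < x" "x < b"
    then have "(6*x-1)*(3*x-1)/(x*(1-2*x)) > 0"
      using that by (intro divide_pos_pos mult_pos_pos mult_neg_neg) auto
    then show "\<exists>y. (\<phi> has_real_derivative y) (at x) \<and> y < 0"
      using der[of x] x that by (intro exI[of _ "- ((6*x-1)*(3*x-1)/(x*(1-2*x)))"]) auto
  next
    show "continuous_on {a..b} \<phi>"
      using that by (intro cont) auto
  qed
  have inc: "\<phi> a < \<phi> b" if "1/6 \<le> a" "a < b" "b \<le> 1/4" for a b
  proof (rule DERIV_pos_imp_increasing_open[OF that(2)])
    fix x assume x: "a < x" "x < b"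
    then have "(6*x-1)*(3*x-1)/(x*(1-2*x)) < 0"
      using that by (intro divide_neg_pos mult_pos_pos mult_pos_neg) auto
    then show "\<exists>y. (\<phi> has_real_derivative y) (at x) \<and> y > 0"
      using der[of x] x that by (intro exI[of _ "- ((6*x-1)*(3*x-1)/(x*(1-2*x)))"]) auto
  next
    show "continuous_on {a..b} \<phi>"
      using that by (intro cont) auto
  qed
  have ln2: "ln (2::real) < 3/4"
  proof -
    have "exp (3/4::real) > 2"
      using exp_lower_Taylor_quadratic[of "3/4::real"] by (simp add: power2_eq_square)
    then show ?thesis by (metis exp_gt_zero ln_less_cancel_iff ln_exp zero_less_numeral)
  qed
  have quarter: "\<phi> (1/4) < 0"
  proof -
    have "\<phi> (1/4) = ln (2::real) - 3/4"
      using ln_realpow[of "2::real" 2] by (simp add: \<phi>_def ln_div)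
    then show ?thesis using ln2 by simp
  qed
  \<comment> \<open>\<open>\<phi> (1/9)\<close> equals ln 7 - 2. The quadratic Taylor bound for exp,
    taken at 1/4 and raised to the eighth power, gives exp 2 > 7.\<close>
  have ninth: "\<phi> (1/9) < 0"
  proof -
    have "exp (2::real) = (exp (1/2))^4" by (simp add: exp_of_nat_mult[symmetric])
    moreover have "(exp (1/2::real))^4 \<ge> (1 + 1/2 + (1/2)^2/2)^4"
      by (intro power_mono exp_lower_Taylor_quadratic) auto
    moreover have "exp (2::real) = (exp (1/4))^8" by (simp add: exp_of_nat_mult[symmetric])
    moreover have "(exp (1/4::real))^8 \<ge> (1 + 1/4 + (1/4)^2/2)^8"
      by (intro power_mono exp_lower_Taylor_quadratic) auto
    moreover have "(1 + 1/4 + (1/4)^2/2::real)^8 > 7" by (simp add: power2_eq_square eval_nat_numeral)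
    ultimately have "exp (2::real) > 7" by linarith
    then have "ln (7::real) < 2" by (metis exp_gt_zero ln_less_cancel_iff ln_exp zero_less_numeral)
    then show ?thesis by (simp add: \<phi>_def ln_div)
  qed
  \<comment> \<open>At 1/30 the logarithms collapse to ln 28, and ln 28 > 3 follows from exp 1 \<le>
    3 because 3^3 = 27 < 28.\<close>
  have pos: "\<phi> (1/30) > 0"
  proof -
    have "exp (3::real) = (exp 1)^3" by (simp add: exp_of_nat_mult[symmetric])
    also have "\<dots> \<le> 3^3" by (intro power_mono exp_le) auto
    also have "\<dots> < (28::real)" by simp
    finally have "3 < ln (28::real)" by (metis exp_gt_zero ln_less_cancel_iff ln_exp zero_less_numeral)
    moreover have "ln (1 - 2 * (1/30::real)) = ln 28 - ln 30" using ln_div[of "28::real" 30] by simp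
    ultimately show ?thesis by (simp add: \<phi>_def ln_div)
  qed
  have neg: "\<phi> t < 0" if "1/9 \<le> t" "t < 1/4" for t
  proof (cases "t \<le> 1/6")
    case True
    from that(1) consider "1/9 < t" | "1/9 = t" by (metis order_le_less)
    then show ?thesis
    proof cases
      case 1 then show ?thesis using dec[of "1/9" t] True ninth by simp
    next
      case 2 from ninth show ?thesis unfolding 2 .
    qed
  next
    case False
    then show ?thesis using inc[of t "1/4"] that quarter by auto
  qed
  have "\<exists>t\<ge>1/30. t \<le> 1/9 \<and> \<phi> t = 0"
    using pos ninth
    by (intro IVT2' cont) auto
  then obtain t where t: "t \<ge> 1/30" "t \<le> 1/9" "\<phi> t = 0" by auto
  show ?thesis
  proof (intro exI conjI allI impI)
    show "0 < t" "9 * t + ln (1 - 2 * t) - ln t - 3 = 0" using t by (auto simp: \<phi>_def)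
    show "t < 1/9" using t ninth by (cases "t = 1/9") auto
    fix s :: real assume s: "0 < s \<and> s < 1/4 \<and> 9 * s + ln (1 - 2 * s) - ln s - 3 = 0"
    then have "\<phi> s = 0" by (simp add: \<phi>_def)
    moreover from this have "s < 1/9" using neg[of s] s by fastforce
    ultimately show "s = t" using dec[of s t] dec[of t s] t s by (cases s t rule: linorder_cases) auto
  qed
qed

text \<open>Existence and uniqueness of the root give the description \<open>l_const\<close> its
  meaning. The equation is kept in the form that yields the exponent k = ln (r/l).\<close>

lemma l_const_pos: "0 < l_const" and l_const_less: "l_const < 1/9"
  and l_const_eq: "ln (r_const / l_const) = 3 - 9 * l_const"
proof -
  obtain t :: real where t: "0 < t" "t < 1/9" "9 * t + ln (1 - 2 * t) - ln t - 3 = 0"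
    and uniq: "\<And>s. 0 < s \<and> s < 1/4 \<and> 9 * s + ln (1 - 2 * s) - ln s - 3 = 0 \<Longrightarrow> s = t"
    using l_equation_solution by blast
  have "l_const = t"
    unfolding l_const_def by (rule the_equality) (use t uniq in auto)
  with t have *: "0 < l_const" "l_const < 1/9" "9 * l_const + ln (1 - 2 * l_const) - ln l_const - 3 = 0"
    by simp_all
  then show "0 < l_const" "l_const < 1/9" by blast+
  show "ln (r_const / l_const) = 3 - 9 * l_const"
    using * by (simp add: r_const_def ln_div)
qed

lemma r_const_bounds: "7/9 < r_const" "r_const < 1"
  using l_const_pos l_const_less by (auto simp: r_const_def)

text \<open>The pieces of \<open>lam\<close> agree at the joints: at l both give r^2, and at r both
  give l r because 1 - r = 2 l. So this formula and the next two include the joints.\<close>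

lemma lam_small: "x \<le> l_const \<Longrightarrow> lam x = (1 - 2 * x)\<^sup>2"
  using l_const_pos r_const_bounds l_const_less
  by (auto simp: lam_def r_const_def power2_eq_square)

lemma lam_mid: "l_const \<le> x \<Longrightarrow> x \<le> r_const \<Longrightarrow> lam x = l_const * r_const\<^sup>2 / x"
  using l_const_pos r_const_bounds l_const_less
  by (auto simp: lam_def r_const_def power2_eq_square divide_simps)

lemma lam_large: "r_const \<le> x \<Longrightarrow> lam x = x * (1 - x) / 2"
  using l_const_pos r_const_bounds l_const_less by (auto simp: lam_def)

lemma continuous_lam: "continuous_on {0..1} lam"
proof -
  have "continuous_on ({0..l_const} \<union> ({l_const..r_const} \<union> {r_const..1})) lam"
  proof (intro continuous_on_closed_Un)
    show "continuous_on {0..l_const} lam"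
      by (rule continuous_on_eq[where f = "\<lambda>x. (1 - 2 * x)\<^sup>2"]) (intro continuous_intros, simp add: lam_small)
    show "continuous_on {l_const..r_const} lam"
      using l_const_pos
      by (subst continuous_on_cong[OF refl lam_mid])
        (auto intro: continuous_on_divide[OF continuous_on_const continuous_on_id])
    show "continuous_on {r_const..1} lam"
      by (rule continuous_on_eq[where f = "\<lambda>x. x * (1 - x) / 2"])
        (intro continuous_on_divide continuous_on_mult continuous_on_diff continuous_on_const continuous_on_id, auto simp: lam_large)
  qed auto
  moreover have "{0..l_const} \<union> ({l_const..r_const} \<union> {r_const..1}) = {0..1}"
    using l_const_pos r_const_bounds l_const_less by auto
  ultimately show ?thesis by simp
qed

lemma lam_strict_decreasing:
  assumes "0 \<le> x" "x < y" "y \<le> 1" shows "lam y < lam x"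
proof -
  have small: "lam y < lam x" if "0 \<le> x" "x < y" "y \<le> l_const" for x y
    using that l_const_less by (simp add: lam_small power_strict_mono)
  have mid: "lam y < lam x" if "l_const \<le> x" "x < y" "y \<le> r_const" for x y
    using that l_const_pos r_const_bounds by (simp add: lam_mid divide_strict_left_mono)
  have large: "lam y < lam x" if "r_const \<le> x" "x < y" for x y
  proof -
    have "x * (1 - x) - y * (1 - y) = (y - x) * (x + y - 1)" by algebra
    also have "\<dots> > 0" using that r_const_bounds by (intro mult_pos_pos) auto
    finally show ?thesis using that by (simp add: lam_large)
  qed
  have lr: "l_const < r_const" using r_const_bounds l_const_less by simp
  consider "y \<le> l_const" | "x < l_const" "l_const < y" "y \<le> r_const" | "x < l_const" "r_const < y"
    | "l_const \<le> x" "y \<le> r_const" | "l_const \<le> x" "x < r_const" "r_const < y" | "r_const \<le> x"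
    by linarith
  then show ?thesis
  proof cases
    case 2 then show ?thesis using small[of x l_const] mid[of l_const y] assms by simp
  next
    case 3 then show ?thesis using small[of x l_const] mid[of l_const r_const] large[of r_const y] assms lr by simp
  next
    case 5 then show ?thesis using mid[of x r_const] large[of r_const y] assms lr by simp
  qed (use assms small mid large in auto)
qed

lemma lam_0: "lam 0 = 1" and lam_1: "lam 1 = 0"
  using l_const_pos r_const_bounds by (simp_all add: lam_small lam_large)

lemma lam_range: "x \<in> {0..1} \<Longrightarrow> lam x \<in> {0..1}"
  using lam_strict_decreasing[of 0 x] lam_strict_decreasing[of x 1] lam_0 lam_1
  by (cases "x = 0"; cases "x = 1") auto

lemma mult_lam_range: "x \<in> {0..1} \<Longrightarrow> x * lam x \<in> {0..1}"
  using lam_range[of x] by (auto intro: mult_le_one)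

text \<open>Supplies, for given x and y, the point w with \<open>lam w = x * y\<close> at which the
  gap, as a function of its third argument, is minimal.\<close>

lemma lam_surj:
  assumes "v \<in> {0..1}" obtains x where "x \<in> {0..1}" "lam x = v"
  using IVT2'[of lam 1 v 0] continuous_lam assms lam_0 lam_1 by auto

section \<open>An integral inequality on the simplex\<close>

lemma integral_reflect_shift_real:
  fixes f :: "real \<Rightarrow> real"
  shows "integral {a..b} (\<lambda>x. f (c - x)) = integral {c-b..c-a} f"
  using integral_shift_real_ivl[of "a-c" "-c" "b-c" "\<lambda>x. f (-x)"] Henstock_Kurzweil_Integration.integral_reflect_real[of "c-a" "c-b" f]
  by simp

lemma integral_nonpos_real:
  fixes f :: "real \<Rightarrow> real"
  assumes "f integrable_on S" "\<And>x. x \<in> S \<Longrightarrow> f x \<le> 0"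
  shows "integral S f \<le> 0"
  using integral_le[OF assms(1) integrable_0] assms(2) by simp

text \<open>The pointwise comparison behind \<open>integral_A_exp_nonpos\<close>: its coefficients
  are those of the bounds for \<open>A\<close> at y, 2/3 - y, 1 - y and 7/6 - y. Dividing by exp (-k
  (2/3 - y)) and putting s = 1/3 - y leaves the fact \<open>key\<close>.\<close>

lemma exp_weights_inequality:
  fixes k y :: real
  assumes k: "2 \<le> k" and y: "1/6 \<le> y" "y \<le> 1/3"
  shows "(1 - 3*y) * (1 - y) / (y * (2 - 3*y)) * exp (- k * (1 - y)) + 4 * exp (- k * (7/6 - y))
          \<le> exp (- k * y) + exp (- k * (2/3 - y))"
proof -
  define s where "s = 1/3 - y"
  have s: "0 \<le> s" "s \<le> 1/6" using y by (auto simp: s_def)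
  define \<phi> where "\<phi> = (1 - 3*y) * (1 - y) / (y * (2 - 3*y))"
  have pos: "0 < y * (2 - 3*y)" using y by (intro mult_pos_pos) auto
  \<comment> \<open>Cleared of denominators, this bounds (1 - y)/(y (2 - 3y)) by 10/3, its value at
    y = 1/6.\<close>
  have "(6*y - 1) * (5*y - 3) \<le> 0" using y by (intro mult_nonneg_nonpos) auto
  then have "3 * (1 - y) \<le> 10 * (y * (2 - 3*y))" by (simp add: algebra_simps)
  then have "(1 - y) / (y * (2 - 3*y)) \<le> 10/3" using pos by (simp add: divide_simps mult.commute)
  then have "(1 - 3*y) * ((1 - y) / (y * (2 - 3*y))) \<le> (1 - 3*y) * (10/3)"
    using y by (intro mult_left_mono) auto
  then have \<phi>: "\<phi> \<le> 10 * s" by (simp add: \<phi>_def s_def)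
  have e23: "exp (- k/3) \<le> 3/5"
  proof -
    have "exp (- k/3) \<le> exp (- (2/3))" using k by simp
    also have "\<dots> = 1 / exp (2/3)" by (simp add: exp_minus divide_simps)
    also have "\<dots> \<le> 1 / (1 + 2/3)" using exp_ge_add_one_self[of "2/3::real"] by (intro divide_left_mono) auto
    finally show ?thesis by simp
  qed
  have e1: "exp (- k/2) \<le> 3/8"
  proof -
    have "exp (- k/2) \<le> exp (- 1)" using k by simp
    also have "\<dots> = 1 / (exp (1/4))^4" by (simp add: exp_minus divide_simps exp_of_nat_mult[symmetric])
    also have "\<dots> \<le> 1 / (1 + 1/4 + (1/4)^2/2)^4"
      by (intro divide_left_mono power_mono mult_pos_pos zero_less_power exp_lower_Taylor_quadratic)
        (auto simp: power2_eq_square)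
    also have "\<dots> \<le> 3/8" by (simp add: power2_eq_square eval_nat_numeral)
    finally show ?thesis .
  qed
  have "\<phi> * exp (- k/3) \<le> 10 * s * (3/5)"
    using \<phi> e23 s by (intro mult_mono) auto
  moreover have "exp (2 * k * s) \<ge> 1 + 4 * s"
  proof -
    have "1 + 4 * s \<le> 1 + 2 * k * s" using mult_right_mono[OF k s(1)] by simp
    also have "\<dots> \<le> exp (2 * k * s)" by (rule exp_ge_add_one_self)
    finally show ?thesis .
  qed
  \<comment> \<open>The bounds reduce the claim to 6 s + 3/2 \<le> 2 + 4 s, which holds because s
    \<le> 1/6.\<close>
  ultimately have key: "\<phi> * exp (- k/3) + 4 * exp (- k/2) \<le> exp (2 * k * s) + 1"
    using e1 s by simp
  have "\<phi> * exp (- k * (1 - y)) + 4 * exp (- k * (7/6 - y))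
     = exp (- k * (1/3 + s)) * (\<phi> * exp (- k/3) + 4 * exp (- k/2))"
    by (simp add: distrib_left exp_add[symmetric] s_def) (simp add: algebra_simps flip: exp_add)
  also have "\<dots> \<le> exp (- k * (1/3 + s)) * (exp (2 * k * s) + 1)"
    using key by (intro mult_left_mono) auto
  also have "\<dots> = exp (- k * y) + exp (- k * (2/3 - y))"
    by (simp add: distrib_left exp_add[symmetric] s_def) (simp add: algebra_simps)
  finally show ?thesis by (simp add: \<phi>_def)
qed

section \<open>Functions with nonpositive sums over the simplex\<close>

locale nonpos_on_simplex =
  fixes \<sigma> :: "real \<Rightarrow> real"
  assumes cont: "continuous_on {0..1} \<sigma>"
    and nonpos: "\<And>a b c. 0 \<le> a \<Longrightarrow> 0 \<le> b \<Longrightarrow> 0 \<le> c \<Longrightarrow> a + b + c = 1 \<Longrightarrow> \<sigma> a + \<sigma> b + \<sigma> c \<le> 0"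
begin

definition A :: "real \<Rightarrow> real" where "A x = integral {0..x} \<sigma>"

lemma A_0: "A 0 = 0"
  by (simp add: A_def)

lemma A_deriv_within: "x \<in> {0..1} \<Longrightarrow> (A has_real_derivative \<sigma> x) (at x within {0..1})"
  unfolding A_def[abs_def] by (rule integral_has_real_derivative[OF cont])

lemma A_deriv: "0 < x \<Longrightarrow> x < 1 \<Longrightarrow> (A has_real_derivative \<sigma> x) (at x)"
  using A_deriv_within[of x] at_within_Icc_at[of 0 x 1] by simp

lemma continuous_A: "continuous_on {0..1} A"
  using A_deriv_within by (rule DERIV_continuous_on)

lemma segment_inequality:
  assumes "0 \<le> p\<^sub>1" "0 \<le> p\<^sub>2" "0 \<le> p\<^sub>3" "p\<^sub>1 + p\<^sub>2 + p\<^sub>3 = 1"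
    and "0 \<le> q\<^sub>1" "0 \<le> q\<^sub>2" "0 \<le> q\<^sub>3" "q\<^sub>1 + q\<^sub>2 + q\<^sub>3 = 1"
    and "p\<^sub>1 \<noteq> q\<^sub>1" "p\<^sub>2 \<noteq> q\<^sub>2" "p\<^sub>3 \<noteq> q\<^sub>3"
  shows "(A q\<^sub>1 - A p\<^sub>1) / (q\<^sub>1 - p\<^sub>1) + (A q\<^sub>2 - A p\<^sub>2) / (q\<^sub>2 - p\<^sub>2) + (A q\<^sub>3 - A p\<^sub>3) / (q\<^sub>3 - p\<^sub>3) \<le> 0"
proof -
  let ?x = "\<lambda>p q t. p + t * (q - p) :: real"
  \<comment> \<open>Each summand has as derivative the value of \<sigma> at its coordinate, so the
    derivative of the sum is nonpositive, and the claim is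
    \<open>?\<Psi> 1 \<le> ?\<Psi> 0\<close>.\<close>
  let ?\<Psi> = "\<lambda>t. A (?x p\<^sub>1 q\<^sub>1 t) / (q\<^sub>1 - p\<^sub>1) + A (?x p\<^sub>2 q\<^sub>2 t) / (q\<^sub>2 - p\<^sub>2) + A (?x p\<^sub>3 q\<^sub>3 t) / (q\<^sub>3 - p\<^sub>3)"
  have le1: "p\<^sub>1 \<le> 1" "p\<^sub>2 \<le> 1" "p\<^sub>3 \<le> 1" "q\<^sub>1 \<le> 1" "q\<^sub>2 \<le> 1" "q\<^sub>3 \<le> 1"
    using assms by auto
  have conv: "?x p q t = (1 - t) * p + t * q" for p q t
    by (simp add: algebra_simps)
  have range: "?x p q t \<in> {0..1}" if "t \<in> {0..1}" "0 \<le> p" "p \<le> 1" "0 \<le> q" "q \<le> 1" for p q t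
    unfolding conv using that convex_bound_le[of p 1 q "1 - t" t] by auto
  \<comment> \<open>Distinct endpoints keep the coordinate strictly between 0 and 1, where
    \<open>A\<close> has a two-sided derivative.\<close>
  have inner: "0 < ?x p q t \<and> ?x p q t < 1" if "0 < t" "t < 1" "0 \<le> p" "p \<le> 1" "0 \<le> q" "q \<le> 1" "p \<noteq> q" for p q t
  proof (cases "p < q")
    case True
    then have "0 < t * (q - p)" "t * (q - p) < 1 * (q - p)"
      using that by (auto intro: mult_strict_right_mono)
    then show ?thesis using that by auto
  next
    case False
    define e where "e = t * (p - q)"
    have "0 < e" "e < 1 * (p - q)"
      unfolding e_def using False that by (auto intro: mult_strict_right_mono)
    moreover have "?x p q t = p - e" unfolding e_def by algebra
    ultimately show ?thesis using that by simp
  qed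
  have contx: "continuous_on {0..1} (\<lambda>t. A (?x p q t))" if "0 \<le> p" "p \<le> 1" "0 \<le> q" "q \<le> 1" for p q
    by (rule continuous_on_compose2[OF continuous_A])
      (use that range in \<open>auto intro!: continuous_intros\<close>)
  have derx: "((\<lambda>t. A (?x p q t) / (q - p)) has_real_derivative \<sigma> (?x p q t)) (at t)"
    if "0 < t" "t < 1" "0 \<le> p" "p \<le> 1" "0 \<le> q" "q \<le> 1" "p \<noteq> q" for p q t
  proof -
    have "((\<lambda>t. ?x p q t) has_real_derivative (q - p)) (at t)"
      by (rule derivative_eq_intros refl)+ simp
    then have "((\<lambda>t. A (?x p q t)) has_real_derivative \<sigma> (?x p q t) * (q - p)) (at t)"
      using inner[of t p q] that by (intro DERIV_chain2[OF A_deriv]) auto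
    from DERIV_cdivide[OF this, of "q - p"] show ?thesis using that by simp
  qed
  have "?\<Psi> 1 \<le> ?\<Psi> 0"
  proof (rule DERIV_nonpos_imp_decreasing_open[of 0 1])
    fix t :: real assume t: "0 < t" "t < 1"
    let ?d = "\<sigma> (?x p\<^sub>1 q\<^sub>1 t) + \<sigma> (?x p\<^sub>2 q\<^sub>2 t) + \<sigma> (?x p\<^sub>3 q\<^sub>3 t)"
    have "(?\<Psi> has_real_derivative ?d) (at t)"
      using t assms le1 by (intro DERIV_add derx) auto
    moreover have "?d \<le> 0"
    proof (rule nonpos)
      have "?x p\<^sub>1 q\<^sub>1 t + ?x p\<^sub>2 q\<^sub>2 t + ?x p\<^sub>3 q\<^sub>3 t
          = (p\<^sub>1 + p\<^sub>2 + p\<^sub>3) + t * ((q\<^sub>1 + q\<^sub>2 + q\<^sub>3) - (p\<^sub>1 + p\<^sub>2 + p\<^sub>3))" by algebra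
      then show "?x p\<^sub>1 q\<^sub>1 t + ?x p\<^sub>2 q\<^sub>2 t + ?x p\<^sub>3 q\<^sub>3 t = 1" using assms by simp
    qed (use inner[OF t] assms le1 in \<open>auto intro: less_imp_le\<close>)
    ultimately show "\<exists>y. (?\<Psi> has_real_derivative y) (at t) \<and> y \<le> 0" by blast
  next
    show "continuous_on {0..1} ?\<Psi>"
      using assms le1 by (intro continuous_on_add continuous_on_divide contx continuous_on_const) auto
  qed simp
  then show ?thesis by (simp add: diff_divide_distrib)
qed

text \<open>Along a segment in the simplex, \<open>\<sigma>\<close> composed with the coordinates has nonpositive sum, so
  the averages of \<open>\<sigma>\<close> over the three coordinate intervals have nonpositive sum. Below, segments
  are chosen so that their coordinate intervals share endpoints and most values of \<open>A\<close> cancel.\<close>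

lemma A_nonpos:
  assumes "A 1 = 0" "0 \<le> y" "y \<le> 1/3" shows "A y \<le> 0"
proof -
  have *: "A y \<le> 0" if y: "0 < y" "y < 1/3" for y
  proof -
    \<comment> \<open>Two segments start at (1, 0, 0): one ends at (y, 1-2y, y), the other at (1-2y,
      y, y). Weighting the second inequality by 2y/(1-2y) and adding cancels
      \<open>A (1 - 2*y)\<close> and leaves a positive multiple of \<open>A y\<close>.\<close>
    have "(A y - A 1) / (y - 1) + (A (1 - 2*y) - A 0) / ((1 - 2*y) - 0) + (A y - A 0) / (y - 0) \<le> 0"
      using y by (intro segment_inequality) auto
    then have 1: "A y / (y - 1) + A (1 - 2*y) / (1 - 2*y) + A y / y \<le> 0"
      using assms by (simp add: A_0)
    have "(A (1 - 2*y) - A 1) / ((1 - 2*y) - 1) + (A y - A 0) / (y - 0) + (A y - A 0) / (y - 0) \<le> 0"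
      using y by (intro segment_inequality) auto
    then have "(2*y / (1 - 2*y)) * (A (1 - 2*y) / (- 2*y) + 2 * (A y / y)) \<le> 0"
      using assms y by (intro mult_nonneg_nonpos) (auto simp: A_0)
    also have "(2*y / (1 - 2*y)) * (A (1 - 2*y) / (- 2*y) + 2 * (A y / y)) = - A (1 - 2*y) / (1 - 2*y) + 4 * A y / (1 - 2*y)"
    proof -
      have "(2*y / d) * (b / (- 2*y) + 2 * (a / y)) = - b / d + 4 * a / d" if "0 < d" for a b d
        using that y by (simp add: field_simps)
      then show ?thesis using y by simp
    qed
    finally have "A y / (y - 1) + A y / y + 4 * A y / (1 - 2*y) \<le> 0"
      using 1 by simp
    also have "A y / (y - 1) + A y / y + 4 * A y / (1 - 2*y) = A y / (y * (1 - y) * (1 - 2*y))"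
      using y by (simp add: divide_simps) algebra
    finally have "A y / (y * (1 - y) * (1 - 2*y)) \<le> 0" .
    moreover have "0 < y * (1 - y) * (1 - 2*y)" using y by (intro mult_pos_pos) auto
    ultimately show ?thesis by (auto simp only: divide_le_0_iff)
  qed
  have "continuous_on {0..1/3} A" by (rule continuous_on_subset[OF continuous_A]) auto
  moreover have "closure {0<..<1/3} = {0..(1/3::real)}" by (simp add: closure_greaterThanLessThan)
  ultimately show ?thesis
    using continuous_le_on_closure[of "{0<..<1/3}" A y 0] * assms by auto
qed

text \<open>The segment joins (y, 1/3, 2/3 - y) to its cyclic shift (2/3 - y, y, 1/3). Two of its
  coordinate intervals have equal length and share the endpoint 1/3, so \<open>A (1/3)\<close>
  cancels.\<close>

lemma A_reflect_le:
  assumes "0 \<le> y" "y \<le> 1/3" shows "A (2/3 - y) \<le> A y"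
proof (cases "y = 1/3")
  case False
  with assms have y: "y < 1/3" by simp
  have "(A (2/3 - y) - A y) / ((2/3 - y) - y) + (A y - A (1/3)) / (y - 1/3) + (A (1/3) - A (2/3 - y)) / (1/3 - (2/3 - y)) \<le> 0"
    using assms y by (intro segment_inequality) auto
  also have "(A (2/3 - y) - A y) / ((2/3 - y) - y) + (A y - A (1/3)) / (y - 1/3) + (A (1/3) - A (2/3 - y)) / (1/3 - (2/3 - y))
     = (A (2/3 - y) - A y) * (3 / (2 * (1/3 - y)))"
    using y by (simp add: divide_simps) algebra
  finally have "(A (2/3 - y) - A y) * (3 / (2 * (1/3 - y))) \<le> 0" .
  moreover have "0 < 3 / (2 * (1/3 - y))" using y by simp
  ultimately show ?thesis unfolding mult_le_0_iff by linarith
next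
  case True
  then have *: "2/3 - y = y" by simp
  show ?thesis unfolding * by (rule order_refl)
qed

text \<open>Again a segment to a cyclic shift, from (0, y, 1-y) to (y, 1-y, 0), with the resulting
  inequality solved for \<open>A (1 - y)\<close>.\<close>

lemma A_one_minus_le:
  assumes "0 < y" "y \<le> 1/3"
  shows "A (1 - y) \<le> - A y * ((1 - 3*y) * (1 - y) / (y * (2 - 3*y)))"
proof -
  have "(A y - A 0) / (y - 0) + (A (1 - y) - A y) / ((1 - y) - y) + (A 0 - A (1 - y)) / (0 - (1 - y)) \<le> 0"
    using assms by (intro segment_inequality) auto
  moreover have "(A 0 - A (1 - y)) / (0 - (1 - y)) = A (1 - y) / (1 - y)"
    using assms by (simp add: A_0 divide_simps algebra_simps)
  ultimately have "A y / y + (A (1 - y) - A y) / (1 - 2*y) + A (1 - y) / (1 - y) \<le> 0"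
    by (simp add: A_0)
  also have "A y / y + (A (1 - y) - A y) / (1 - 2*y) + A (1 - y) / (1 - y)
     = (A (1 - y) + A y * ((1 - 3*y) * (1 - y) / (y * (2 - 3*y)))) * ((2 - 3*y) / ((1 - 2*y) * (1 - y)))"
    using assms by (simp add: divide_simps) algebra
  finally show ?thesis using assms by (simp add: mult_le_0_iff divide_le_0_iff)
qed

text \<open>The segment from (7/6 - y, u, u) to (1 - 2y, y, y), with u chosen to make the
  coordinates sum to 1, bounds \<open>A (7/6 - y)\<close> by
  \<open>A (1 - 2*y) + 4 * A u - 4 * A y\<close>, whose first two terms are nonpositive.\<close>

lemma A_corner_le:
  assumes "A 1 = 0" "1/6 \<le> y" "y \<le> 1/3"
  shows "A (7/6 - y) \<le> - 4 * A y"
proof (cases "y = 1/6")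
  case True
  then have "7/6 - y = 1" by simp
  then show ?thesis using A_nonpos[of y] assms by simp
next
  case False
  with assms have y: "1/6 < y" by simp
  define u where "u = (y - 1/6) / 2"
  have "(A (1 - 2*y) - A (7/6 - y)) / ((1 - 2*y) - (7/6 - y)) + (A y - A u) / (y - u) + (A y - A u) / (y - u) \<le> 0"
    using assms y by (intro segment_inequality) (auto simp: u_def)
  also have "(A (1 - 2*y) - A (7/6 - y)) / ((1 - 2*y) - (7/6 - y)) + (A y - A u) / (y - u) + (A y - A u) / (y - u)
    = (A (7/6 - y) - A (1 - 2*y) + 4 * A y - 4 * A u) * (1 / (1/6 + y))"
  proof -
    have "(1 - 2*y) - (7/6 - y) = - (1/6 + y)" "y - u = (1/6 + y) / 2"
      by (simp_all add: u_def field_simps)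
    then show ?thesis using y by (simp only:) (simp add: divide_simps)
  qed
  finally have "A (7/6 - y) \<le> A (1 - 2*y) + 4 * A u - 4 * A y"
    using y by (simp add: divide_le_0_iff)
  moreover have "A u \<le> 0" using assms y by (intro A_nonpos) (auto simp: u_def)
  \<comment> \<open>1 - 2y is the reflection 2/3 - (2y - 1/3) of a point of [0, 1/3].\<close>
  moreover have "A (1 - 2*y) \<le> 0"
    using A_reflect_le[of "2*y - 1/3"] A_nonpos[of "2*y - 1/3"] assms by simp
  ultimately show ?thesis by simp
qed

text \<open>The unit interval is cut at multiples of 1/6. The nonpositive pieces over [0, 1/6] and
  [1/2, 2/3] are dropped. The pieces over [1/3, 1/2], [2/3, 5/6] and [5/6, 1] are the images of
  [1/6, 1/3] under 2/3 - y, 1 - y and 7/6 - y.\<close>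

lemma integral_A_exp_nonpos:
  fixes k :: real
  assumes A1: "A 1 = 0" and k: "2 \<le> k"
  shows "integral {0..1} (\<lambda>x. A x * exp (- k * x)) \<le> 0"
proof -
  define f where "f = (\<lambda>x. A x * exp (- k * x))"
  have contf: "continuous_on {0..1} f"
    unfolding f_def by (intro continuous_intros continuous_A)
  have intf: "f integrable_on {a..b}" if "0 \<le> a" "b \<le> 1" for a b
    using that by (intro integrable_continuous_real continuous_on_subset[OF contf]) auto
  have comb: "integral {a..b} f = integral {a..c} f + integral {c..b} f" if "0 \<le> a" "a \<le> c" "c \<le> b" "b \<le> 1" for a b c
    using that Henstock_Kurzweil_Integration.integral_combine[of a c b f] intf[of a b] by simp
  have refl: "integral {c-b..c-a} f = integral {a..b} (\<lambda>y. f (c - y))" for a b c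
    by (simp add: integral_reflect_shift_real)
  have intr: "(\<lambda>y. f (c - y)) integrable_on {1/6..1/3}" if "1/3 \<le> c" "c \<le> 7/6" for c
    by (rule integrable_continuous_real, rule continuous_on_compose2[OF contf])
      (use that in \<open>auto intro!: continuous_intros\<close>)
  have neg: "integral {a..b} f \<le> 0" if "0 \<le> a" "b \<le> 2/3" for a b
  proof (rule integral_nonpos_real)
    fix x assume "x \<in> {a..b}"
    then have "A x \<le> 0"
      using that A_nonpos[OF A1, of x] A_nonpos[OF A1, of "2/3 - x"] A_reflect_le[of "2/3 - x"]
      by (cases "x \<le> 1/3") auto
    then show "f x \<le> 0" by (simp add: f_def mult_le_0_iff)
  qed (use that intf in auto)
  \<comment> \<open>Reflections move the intervals where the sign of \<open>A\<close> is unknown onto \<open>[1/6, 1/3]\<close>, where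
    the comparison can be made pointwise.\<close>
  have "integral {0..1} f = integral {0..1/6} f + integral {1/6..1/3} f + integral {1/3..1/2} f
      + integral {1/2..2/3} f + integral {2/3..5/6} f + integral {5/6..1} f"
    using comb[of 0 "1/6" 1] comb[of "1/6" "1/3" 1] comb[of "1/3" "1/2" 1] comb[of "1/2" "2/3" 1] comb[of "2/3" "5/6" 1]
    by simp
  also have "\<dots> \<le> integral {1/6..1/3} f + integral {1/3..1/2} f + integral {2/3..5/6} f + integral {5/6..1} f"
    using neg[of 0 "1/6"] neg[of "1/2" "2/3"] by simp
  also have "\<dots> = integral {1/6..1/3} f + integral {1/6..1/3} (\<lambda>y. f (2/3 - y))
       + integral {1/6..1/3} (\<lambda>y. f (1 - y)) + integral {1/6..1/3} (\<lambda>y. f (7/6 - y))"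
    using refl[of "2/3" "1/3" "1/6"] refl[of "1" "1/3" "1/6"] refl[of "7/6" "1/3" "1/6"] by simp
  also have "\<dots> = integral {1/6..1/3} (\<lambda>y. f y + f (2/3 - y) + f (1 - y) + f (7/6 - y))"
    using intr[of "2/3"] intr[of 1] intr[of "7/6"] intf[of "1/6" "1/3"]
    by (simp add: Henstock_Kurzweil_Integration.integral_add integrable_add)
  also have "\<dots> \<le> 0"
  proof (rule integral_nonpos_real)
    show "(\<lambda>y. f y + f (2/3 - y) + f (1 - y) + f (7/6 - y)) integrable_on {1/6..1/3}"
      using intr[of "2/3"] intr[of 1] intr[of "7/6"] intf[of "1/6" "1/3"] by (intro integrable_add) auto
    fix y :: real assume "y \<in> {1/6..1/3}"
    then have y: "1/6 \<le> y" "y \<le> 1/3" by auto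
    define \<phi> where "\<phi> = (1 - 3*y) * (1 - y) / (y * (2 - 3*y))"
    have "A (2/3 - y) \<le> A y" using y by (intro A_reflect_le) auto
    moreover have "A (1 - y) \<le> - A y * \<phi>" unfolding \<phi>_def using y by (intro A_one_minus_le) auto
    moreover have "A (7/6 - y) \<le> - 4 * A y" using y A1 by (intro A_corner_le)
    ultimately have "f y + f (2/3 - y) + f (1 - y) + f (7/6 - y) \<le>
       A y * exp (- k * y) + A y * exp (- k * (2/3 - y)) + (- A y * \<phi>) * exp (- k * (1 - y))
         + (- 4 * A y) * exp (- k * (7/6 - y))"
      unfolding f_def by (intro add_mono mult_right_mono) auto
    also have "\<dots> = - A y * ((\<phi> * exp (- k * (1 - y)) + 4 * exp (- k * (7/6 - y))) - (exp (- k * y) + exp (- k * (2/3 - y))))"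
      by algebra
    also have "\<dots> \<le> 0"
      using exp_weights_inequality[OF k y] A_nonpos[OF A1, of y] y
      by (intro mult_nonneg_nonpos) (auto simp: \<phi>_def)
    finally show "f y + f (2/3 - y) + f (1 - y) + f (7/6 - y) \<le> 0" .
  qed
  finally show ?thesis by (simp add: f_def)
qed

lemma integral_by_parts_exp:
  "((\<lambda>x. \<sigma> x * exp (- k * x) - k * (A x * exp (- k * x))) has_integral A 1 * exp (- k)) {0..1}"
proof -
  have "((\<lambda>x. \<sigma> x * exp (- k * x) - k * (A x * exp (- k * x))) has_integral (A 1 * exp (- k * 1) - A 0 * exp (- k * 0))) {0..1}"
  proof (rule fundamental_theorem_of_calculus)
    fix x :: real assume x: "x \<in> {0..1}"
    have "((\<lambda>x. A x * exp (- k * x)) has_real_derivative \<sigma> x * exp (- k * x) - k * (A x * exp (- k * x))) (at x within {0..1})"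
      by (rule derivative_eq_intros A_deriv_within[OF x] refl)+ (simp add: algebra_simps)
    then show "((\<lambda>x. A x * exp (- k * x)) has_vector_derivative \<sigma> x * exp (- k * x) - k * (A x * exp (- k * x))) (at x within {0..1})"
      by (simp add: has_real_derivative_iff_has_vector_derivative)
  qed simp
  then show ?thesis by (simp add: A_0)
qed

text \<open>With \<open>A 1 = 0\<close> the boundary term of the integration by parts vanishes, so
  the integral is k times that of \<open>A x * exp (- k * x)\<close>.\<close>

lemma integral_exp_nonpos_centered:
  assumes "A 1 = 0" "2 \<le> k"
  shows "integral {0..1} (\<lambda>x. \<sigma> x * exp (- k * x)) \<le> 0"
proof -
  have "(\<lambda>x. \<sigma> x * exp (- k * x)) integrable_on {0..1}" "(\<lambda>x. k * (A x * exp (- k * x))) integrable_on {0..1}"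
    by (intro integrable_continuous_real continuous_intros cont continuous_A)+
  then have "integral {0..1} (\<lambda>x. \<sigma> x * exp (- k * x)) - k * integral {0..1} (\<lambda>x. A x * exp (- k * x)) = 0"
    using integral_unique[OF integral_by_parts_exp[of k]] assms
    by (simp add: Henstock_Kurzweil_Integration.integral_diff)
  then show ?thesis
    using integral_A_exp_nonpos[of k] assms by (simp add: mult_le_0_iff)
qed

end

text \<open>The assumption \<open>mean\<close> is the vanishing of the integral of (x - 1/3) exp (-k
  x) in closed form. Subtracting a multiple of x - 1/3 from \<sigma> therefore preserves the
  weighted integral as well as the simplex condition, which reduces the claim to the centered
  case.\<close>

lemma (in nonpos_on_simplex) integral_exp_nonpos:
  assumes k: "2 \<le> k" and mean: "3 * (1 - exp (- k)) = k * (1 + 2 * exp (- k))"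
  shows "integral {0..1} (\<lambda>x. \<sigma> x * exp (- k * x)) \<le> 0"
proof -
  have moment: "((\<lambda>x. (x - 1/3) * exp (- k * x)) has_integral 0) {0..1}"
  proof -
    have "((\<lambda>x. (x - 1/3) * exp (- k * x)) has_integral
       (- (1 - 1/3) * exp (- k * 1) / k - exp (- k * 1) / k\<^sup>2) - (- (0 - 1/3) * exp (- k * 0) / k - exp (- k * 0) / k\<^sup>2)) {0..1}"
    proof (rule fundamental_theorem_of_calculus)
      fix x :: real
      have "((\<lambda>x. - (x - 1/3) * exp (- k * x) / k - exp (- k * x) / k\<^sup>2) has_real_derivative (x - 1/3) * exp (- k * x)) (at x within {0..1})"
        by (rule derivative_eq_intros refl | use k in force)+
          (use k in \<open>simp add: divide_simps power2_eq_square\<close>, (algebra)?)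
      then show "((\<lambda>x. - (x - 1/3) * exp (- k * x) / k - exp (- k * x) / k\<^sup>2) has_vector_derivative (x - 1/3) * exp (- k * x)) (at x within {0..1})"
        by (simp add: has_real_derivative_iff_has_vector_derivative)
    qed simp
    moreover have "(- (1 - 1/3) * exp (- k * 1) / k - exp (- k * 1) / k\<^sup>2) - (- (0 - 1/3) * exp (- k * 0) / k - exp (- k * 0) / k\<^sup>2)
       = (3 * (1 - exp (- k)) - k * (1 + 2 * exp (- k))) / (3 * k\<^sup>2)"
      using k by (simp add: divide_simps power2_eq_square) algebra
    ultimately show ?thesis using mean by simp
  qed
  \<comment> \<open>\<open>a - 1/3\<close> sums to 0 over the simplex and has integral 1/6, so it can be used to normalise \<open>A 1 = 0\<close>.\<close>
  define m where "m = 6 * A 1"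
  define \<sigma>' where "\<sigma>' = (\<lambda>x. \<sigma> x - m * (x - 1/3))"
  interpret centered: nonpos_on_simplex \<sigma>'
  proof
    show "continuous_on {0..1} \<sigma>'" unfolding \<sigma>'_def by (intro continuous_intros cont)
    fix a b c :: real assume *: "0 \<le> a" "0 \<le> b" "0 \<le> c" "a + b + c = 1"
    have "\<sigma>' a + \<sigma>' b + \<sigma>' c = \<sigma> a + \<sigma> b + \<sigma> c - m * (a + b + c - 1)"
      by (simp add: \<sigma>'_def algebra_simps)
    then show "\<sigma>' a + \<sigma>' b + \<sigma>' c \<le> 0" using nonpos[OF *] * by simp
  qed
  have lin: "((\<lambda>x::real. m * (x - 1/3)) has_integral m * (1/6)) {0..1}"
  proof (rule has_integral_mult_right)
    have "((\<lambda>x::real. x - 1/3) has_integral (1\<^sup>2 / 2 - 1 / 3) - (0\<^sup>2 / 2 - 0 / 3)) {0..1}"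
      by (rule fundamental_theorem_of_calculus)
        (auto simp flip: has_real_derivative_iff_has_vector_derivative intro!: derivative_eq_intros)
    then show "((\<lambda>x::real. x - 1/3) has_integral 1/6) {0..1}" by simp
  qed
  have "(\<sigma> has_integral A 1) {0..1}"
    unfolding A_def using cont by (intro integrable_integral integrable_continuous_real)
  from has_integral_diff[OF this lin] have "(\<sigma>' has_integral 0) {0..1}"
    by (simp add: \<sigma>'_def m_def)
  then have "centered.A 1 = 0"
    unfolding centered.A_def by (rule integral_unique)
  then have "integral {0..1} (\<lambda>x. \<sigma>' x * exp (- k * x)) \<le> 0"
    using k by (rule centered.integral_exp_nonpos_centered)
  moreover have "((\<lambda>x. \<sigma>' x * exp (- k * x) + m * ((x - 1/3) * exp (- k * x))) has_integral
      integral {0..1} (\<lambda>x. \<sigma>' x * exp (- k * x)) + m * 0) {0..1}"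
    by (intro has_integral_add integrable_integral has_integral_mult_right moment
        integrable_continuous_real continuous_intros centered.cont)
  ultimately show ?thesis
    by (simp add: \<sigma>'_def algebra_simps integral_unique)
qed

section \<open>The gap between cost and potentials\<close>

text \<open>The parameter u of a curve point (u, 1-2u, 1-2u) having t among its coordinates. All of
  [l, r] is sent to l, where the curves meet \<open>M_2\<close>. Then t \<lambda>(t) is the product
  of the coordinates of that point.\<close>

definition M_param :: "real \<Rightarrow> real" where
  "M_param t = (if t < l_const then t else if t \<le> r_const then l_const else (1 - t) / 2)"

lemma mult_lam_eq:
  assumes "t \<in> {0..1}"
  shows "t * lam t = M_param t * (1 - 2 * M_param t)\<^sup>2"
proof -
  consider "t < l_const" | "l_const \<le> t" "t \<le> r_const" | "r_const < t" by linarith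
  then show ?thesis
  proof cases
    case 1 then show ?thesis by (simp add: M_param_def lam_small)
  next
    case 2 then show ?thesis using l_const_pos by (simp add: M_param_def lam_mid r_const_def)
  next
    case 3
    moreover have "l_const < r_const" using r_const_bounds l_const_less by simp
    ultimately have "M_param t = (1 - t) / 2" "lam t = t * (1 - t) / 2"
      by (simp_all add: M_param_def lam_large)
    moreover from this have "1 - 2 * M_param t = t" by (simp add: field_simps)
    ultimately show ?thesis by (simp only: power2_eq_square) simp
  qed
qed

lemma M_param_range: "t \<in> {0..1} \<Longrightarrow> M_param t \<in> {0..l_const}"
  using l_const_pos by (auto simp: M_param_def r_const_def)

lemma M_param_cases:
  assumes "M_param t < l_const" shows "t = M_param t \<or> t = 1 - 2 * M_param t"
  using assms by (auto simp: M_param_def field_simps split: if_splits)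

lemma M_param_top: "M_param t = l_const \<Longrightarrow> t \<in> {l_const..r_const}"
  by (auto simp: M_param_def r_const_def split: if_splits)

text \<open>The difference of the two values factors through u - v, and the cofactor is positive
  because u + v < 2/9.\<close>

lemma inj_on_M_param_profile:
  assumes "u \<in> {0..l_const}" "v \<in> {0..l_const}" "u * (1 - 2 * u)\<^sup>2 = v * (1 - 2 * v)\<^sup>2"
  shows "u = v"
proof -
  have "u * (1 - 2 * u)\<^sup>2 - v * (1 - 2 * v)\<^sup>2 = (u - v) * (1 - 4 * (u + v) + 4 * (u\<^sup>2 + u * v + v\<^sup>2))"
    by algebra
  moreover have "0 < 1 - 4 * (u + v) + 4 * (u\<^sup>2 + u * v + v\<^sup>2)"
    using assms l_const_less by (intro add_pos_nonneg) auto
  ultimately show ?thesis using assms by simp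
qed

text \<open>All of x \<lambda>(x), y \<lambda>(y), z \<lambda>(z) equal xyz, so the coordinates
  share one parameter u. If u = l, the point lies on \<open>M_2\<close>. Otherwise each coordinate
  is u or 1 - 2u. Two copies of u are excluded by u s < 1/9 < (7/9)^2 \<le> \<lambda>(u), three
  copies of 1 - 2u by (1 - 2u)(1 - 3u) > 0.\<close>

lemma critical_point_in_M_set:
  assumes "x \<in> {0..1}" "y \<in> {0..1}" "z \<in> {0..1}"
    and eqs: "x * y = lam z" "y * z = lam x" "x * z = lam y"
  shows "(x, y, z) \<in> M_set"
proof -
  define u where "u = M_param x"
  have "x * lam x = y * lam y" "x * lam x = z * lam z"
    by (simp_all flip: eqs)
  then have "M_param y = u" "M_param z = u"
    using assms M_param_range inj_on_M_param_profile unfolding u_def by (metis mult_lam_eq)+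
  then have u: "M_param x = u" "M_param y = u" "M_param z = u" by (auto simp: u_def)
  have range: "u \<in> {0..l_const}" using M_param_range[of x] assms by (simp add: u_def)
  show ?thesis
  proof (cases "u = l_const")
    case True
    then have "x \<in> {l_const..r_const}" "y \<in> {l_const..r_const}" "z \<in> {l_const..r_const}"
      using M_param_top u unfolding True by blast+
    moreover from this have "x * y * z = l_const * r_const\<^sup>2"
      using l_const_pos by (simp add: eqs lam_mid)
    ultimately show ?thesis by (simp add: M_set_def M_2_def)
  next
    case False
    then have ul: "u < l_const" using range by simp
    with range have lam_u: "lam u = (1 - 2 * u)\<^sup>2" "lam (1 - 2 * u) = u * (1 - 2 * u)"
      by (simp_all add: lam_small lam_large r_const_def)
    have u_small: "0 \<le> u" "u < 1/9" using range ul l_const_less by auto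
    have two: False if "s \<in> {0..1}" "u * s = lam u" for s
    proof -
      have "u * s \<le> u" by (rule mult_left_le) (use that u_small in auto)
      moreover have "(7/9)\<^sup>2 \<le> (1 - 2 * u)\<^sup>2" using u_small by (intro power_mono) auto
      ultimately show False using that u_small lam_u by (simp add: power2_eq_square)
    qed
    have three: False if "(1 - 2 * u) * (1 - 2 * u) = lam (1 - 2 * u)"
    proof -
      have "(1 - 2 * u) * (1 - 3 * u) = 0" using that unfolding lam_u by algebra
      then show False using u_small by simp
    qed
    have "x = u \<or> x = 1 - 2 * u" "y = u \<or> y = 1 - 2 * u" "z = u \<or> z = 1 - 2 * u"
      using u ul M_param_cases by metis+
    moreover have "\<not> (x = u \<and> y = u)" "\<not> (x = u \<and> z = u)" "\<not> (y = u \<and> z = u)"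
      using two[OF assms(3)] two[OF assms(2)] two[OF assms(1)] eqs by (auto simp: mult.commute)
    moreover have "\<not> (x = 1 - 2 * u \<and> y = 1 - 2 * u \<and> z = 1 - 2 * u)"
      using three eqs(1) by blast
    ultimately consider "x = u" "y = 1 - 2 * u" "z = 1 - 2 * u" | "y = u" "x = 1 - 2 * u" "z = 1 - 2 * u"
      | "z = u" "x = 1 - 2 * u" "y = 1 - 2 * u"
      by blast
    then have "(x, y, z) \<in> M_x \<or> (x, y, z) \<in> M_y \<or> (x, y, z) \<in> M_z"
      using range unfolding M_x_def M_y_def M_z_def by cases auto
    then show ?thesis by (auto simp: M_set_def)
  qed
qed

section \<open>Slices, minimisers and constancy of the gap\<close>

locale increasing_cost =
  fixes C C' :: "real \<Rightarrow> real"
  assumes C_deriv: "\<And>t. t \<in> {0..1} \<Longrightarrow> (C has_real_derivative C' t) (at t within {0..1})"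
    and C'_cont: "continuous_on {0..1} C'"
    and strict_incr: "strict_mono_on {0..1} (\<lambda>t. t * C' t)"
begin

lemma C_cont: "continuous_on {0..1} C"
  using C_deriv by (rule DERIV_continuous_on)

lemma C_deriv_at: "0 < t \<Longrightarrow> t < 1 \<Longrightarrow> (C has_real_derivative C' t) (at t)"
  using C_deriv[of t] at_within_Icc_at[of 0 t 1] by simp

lemma continuous_fhat_integrand: "continuous_on {0..1} (\<lambda>t. lam t * C' (t * lam t))"
  by (intro continuous_intros continuous_lam continuous_on_compose2[OF C'_cont])
    (use mult_lam_range in auto)

lemma fhat_deriv_within:
  "s \<in> {0..1} \<Longrightarrow> (fhat C' has_real_derivative lam s * C' (s * lam s)) (at s within {0..1})"
  unfolding fhat_def[abs_def] by (rule integral_has_real_derivative[OF continuous_fhat_integrand])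

lemma fhat_deriv:
  "0 < s \<Longrightarrow> s < 1 \<Longrightarrow> (fhat C' has_real_derivative lam s * C' (s * lam s)) (at s)"
  using fhat_deriv_within[of s] at_within_Icc_at[of 0 s 1] by simp

lemma continuous_fhat: "continuous_on {0..1} (fhat C')"
  using fhat_deriv_within by (rule DERIV_continuous_on)

lemma fhat_0: "fhat C' 0 = 0"
  by (simp add: fhat_def)

lemma slice_deriv:
  assumes v: "v \<in> {0..1}" and z: "0 < z" "z < 1"
  shows "((\<lambda>z. C (v * z) - fhat C' z) has_real_derivative v * C' (v * z) - lam z * C' (z * lam z)) (at z)"
proof -
  \<comment> \<open>For v = 0 the point v z is the endpoint 0, where only a one-sided derivative of
    \<open>C\<close> is given, so the chain rule is applied within the interval.\<close>
  have sub: "(\<lambda>z. v * z) ` {0..1} \<subseteq> {0..1}" using v by (auto intro: mult_le_one)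
  have "(C has_real_derivative C' (v * z)) (at (v * z) within (\<lambda>z. v * z) ` {0..1})"
    using v z mult_le_one[of v z] by (intro DERIV_subset[OF C_deriv sub]) auto
  moreover have "((\<lambda>z. v * z) has_real_derivative v) (at z within {0..1})"
    by (rule derivative_eq_intros refl)+ simp
  ultimately have "(C \<circ> (\<lambda>z. v * z) has_real_derivative C' (v * z) * v) (at z within {0..1})"
    by (rule DERIV_image_chain)
  then have "((\<lambda>z. C (v * z)) has_real_derivative v * C' (v * z)) (at z)"
    using z at_within_Icc_at[of 0 z 1] by (simp add: o_def mult.commute)
  then show ?thesis using fhat_deriv[OF z] by (rule DERIV_diff)
qed

text \<open>The derivative of the slice at \<open>z\<close>, multiplied by \<open>z\<close>, is the difference of the
  values of \<open>t C'(t)\<close> at \<open>v z\<close> and \<open>z \<lambda>(z)\<close>, so its sign is that of \<open>v - \<lambda>(z)\<close>.\<close>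

lemma slice_strict_minimum:
  assumes z0: "z0 \<in> {0..1}" and z: "z \<in> {0..1}" "z \<noteq> z0"
  shows "C (lam z0 * z0) - fhat C' z0 < C (lam z0 * z) - fhat C' z"
proof -
  let ?v = "lam z0"
  let ?h = "\<lambda>z. C (?v * z) - fhat C' z"
  let ?h' = "\<lambda>z. ?v * C' (?v * z) - lam z * C' (z * lam z)"
  have v: "?v \<in> {0..1}" using z0 by (rule lam_range)
  have cont: "continuous_on {a..b} ?h" if "0 \<le> a" "b \<le> 1" for a b
  proof (rule continuous_on_subset[of "{0..1}"])
    show "continuous_on {0..1} ?h"
      by (intro continuous_on_diff continuous_fhat continuous_on_compose2[OF C_cont] continuous_intros)
        (use v in \<open>auto intro: mult_le_one\<close>)
  qed (use that in auto)
  have range: "?v * w \<in> {0..1}" "w * lam w \<in> {0..1}" if "0 < w" "w < 1" for w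
    using that v mult_lam_range[of w] by (auto intro: mult_le_one)
  have scaled: "w * ?h' w = ?v * w * C' (?v * w) - w * lam w * C' (w * lam w)" for w
    by (simp add: algebra_simps)
  show ?thesis
  proof (cases "z0 < z")
    case True
    have "?h z0 < ?h z"
    proof (rule DERIV_pos_imp_increasing_open[OF True])
      fix w assume w: "z0 < w" "w < z"
      then have w01: "0 < w" "w < 1" using z0 z by auto
      have "w * lam w < ?v * w"
        using w z z0 w01 lam_strict_decreasing[of z0 w] by simp
      then have "0 < w * ?h' w"
        unfolding scaled using strict_mono_onD[OF strict_incr range(2)[OF w01] range(1)[OF w01]] by simp
      then have "0 < ?h' w" using w01 by (simp only: zero_less_mult_iff) auto
      with slice_deriv[OF v w01] show "\<exists>y. (?h has_real_derivative y) (at w) \<and> 0 < y" by blast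
    qed (use z0 z cont in auto)
    then show ?thesis .
  next
    case False
    then have less: "z < z0" using z by simp
    have "?h z0 < ?h z"
    proof (rule DERIV_neg_imp_decreasing_open[OF less])
      fix w assume w: "z < w" "w < z0"
      then have w01: "0 < w" "w < 1" using z0 z by auto
      have "?v * w < w * lam w"
        using w z z0 w01 lam_strict_decreasing[of w z0] by simp
      then have "w * ?h' w < 0"
        unfolding scaled using strict_mono_onD[OF strict_incr range(1)[OF w01] range(2)[OF w01]] by simp
      then have "?h' w < 0" using w01 by (simp only: mult_less_0_iff) auto
      with slice_deriv[OF v w01] show "\<exists>y. (?h has_real_derivative y) (at w) \<and> y < 0" by blast
    qed (use z0 z cont in auto)
    then show ?thesis .
  qed
qed

definition gap :: "real \<Rightarrow> real \<Rightarrow> real \<Rightarrow> real" where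
  "gap x y z = C (x * y * z) - fhat C' x - fhat C' y - fhat C' z"

lemma gap_commute: "gap x y z = gap y x z" "gap x y z = gap x z y"
  by (simp_all add: gap_def mult_ac)

text \<open>The slice has a unique minimiser w, where \<open>lam w = x * y\<close>. Arguing by
  uniqueness instead of a vanishing derivative also covers z on the boundary.\<close>

lemma gap_minimizer_slice:
  assumes "x \<in> {0..1}" "y \<in> {0..1}" "z \<in> {0..1}"
    and min: "\<And>w. w \<in> {0..1} \<Longrightarrow> gap x y z \<le> gap x y w"
  shows "x * y = lam z"
proof -
  have "x * y \<in> {0..1}" using assms by (auto intro: mult_le_one)
  then obtain w where w: "w \<in> {0..1}" "lam w = x * y" by (rule lam_surj)
  have "z = w"
  proof (rule ccontr)
    assume "z \<noteq> w"
    from slice_strict_minimum[OF w(1) assms(3) this] have "gap x y w < gap x y z"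
      by (simp add: gap_def w)
    with min[OF w(1)] show False by simp
  qed
  with w show ?thesis by simp
qed

text \<open>Compactness gives a minimiser over the cube. It minimises each of its three slices, so
  it satisfies the equations of \<open>critical_point_in_M_set\<close>.\<close>

lemma gap_attains_minimum_in_M_set:
  obtains a b c where "(a, b, c) \<in> M_set" "\<And>x y z. (x, y, z) \<in> unit_cube \<Longrightarrow> gap a b c \<le> gap x y z"
proof -
  let ?g = "\<lambda>p. gap (fst p) (fst (snd p)) (snd (snd p))"
  have "continuous_on unit_cube ?g"
    unfolding gap_def
    by (intro continuous_on_diff continuous_on_compose2[OF C_cont] continuous_on_compose2[OF continuous_fhat] continuous_intros)
      (auto intro!: mult_le_one)
  moreover have "compact unit_cube" by (intro compact_Times compact_Icc)
  moreover have "unit_cube \<noteq> {}" by auto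
  ultimately have "\<exists>p\<in>unit_cube. \<forall>q\<in>unit_cube. ?g p \<le> ?g q"
    by (intro continuous_attains_inf)
  then obtain p where p: "p \<in> unit_cube" "\<forall>q\<in>unit_cube. ?g p \<le> ?g q" ..
  obtain a b c where abc: "p = (a, b, c)" by (rule prod_cases3)
  have min: "gap a b c \<le> gap x y z" if "(x, y, z) \<in> unit_cube" for x y z
    using bspec[OF p(2) that] abc by simp
  have range: "a \<in> {0..1}" "b \<in> {0..1}" "c \<in> {0..1}" using p abc by auto
  have "(a, b, c) \<in> M_set"
  proof (rule critical_point_in_M_set[OF range])
    show "a * b = lam c"
      by (rule gap_minimizer_slice) (use range min in auto)
    show "b * c = lam a"
    proof (rule gap_minimizer_slice)
      fix w :: real assume "w \<in> {0..1}"
      then show "gap b c a \<le> gap b c w"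
        using min[of w b c] range gap_commute[of b c] gap_commute[of b a c] gap_commute[of b w c] by simp
    qed (use range in auto)
    show "a * c = lam b"
    proof (rule gap_minimizer_slice)
      fix w :: real assume "w \<in> {0..1}"
      then show "gap a c b \<le> gap a c w"
        using min[of a w c] range gap_commute[of a c] by simp
    qed (use range in auto)
  qed
  then show ?thesis using min by (rule that)
qed

text \<open>All terms of the derivative along the curve carry the factor C'(t (1 - 2t)^2), and their
  coefficients (1-2t)(1-6t), -(1-2t)^2 and 4t(1-2t) sum to 0. The constant is read off at (0, 1,
  1).\<close>

lemma gap_on_curve:
  assumes "0 \<le> t" "t \<le> l_const"
  shows "gap t (1 - 2 * t) (1 - 2 * t) = C 0 - 2 * fhat C' 1"
proof (cases "t = 0")
  case True
  then show ?thesis by (simp add: gap_def fhat_0)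
next
  case False
  with assms have t: "0 < t" by simp
  let ?\<phi> = "\<lambda>t. C (t * (1 - 2 * t)\<^sup>2) - fhat C' t - 2 * fhat C' (1 - 2 * t)"
  have "?\<phi> t = ?\<phi> 0"
  proof (rule DERIV_isconst_end[OF t])
    show "continuous_on {0..t} ?\<phi>"
    proof (intro continuous_on_diff continuous_on_mult continuous_on_const
        continuous_on_compose2[OF C_cont] continuous_on_compose2[OF continuous_fhat] continuous_intros)
      show "(\<lambda>t. t * (1 - 2 * t)\<^sup>2) ` {0..t} \<subseteq> {0..1}"
        using assms l_const_less by (auto intro!: mult_le_one power_le_one)
    qed (use assms l_const_less in auto)
    fix x assume x: "0 < x" "x < t"
    then have xl: "x < l_const" "x < 1/9" using assms l_const_less by auto
    have P: "0 < x * (1 - 2 * x)\<^sup>2" "x * (1 - 2 * x)\<^sup>2 < 1"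
    proof -
      show "0 < x * (1 - 2 * x)\<^sup>2" using x xl by simp
      have "x * (1 - 2 * x)\<^sup>2 \<le> x * 1" using x xl by (intro mult_left_mono power_le_one) auto
      then show "x * (1 - 2 * x)\<^sup>2 < 1" using xl by simp
    qed
    have lams: "lam x = (1 - 2 * x)\<^sup>2" "lam (1 - 2 * x) = x * (1 - 2 * x)"
      using x xl by (simp_all add: lam_small lam_large r_const_def)
    have "((\<lambda>t. t * (1 - 2 * t)\<^sup>2) has_real_derivative (1 - 2 * x) * (1 - 6 * x)) (at x)"
      by (rule derivative_eq_intros refl)+ (simp add: algebra_simps power2_eq_square)
    from DERIV_chain2[OF C_deriv_at[OF P] this]
    have 1: "((\<lambda>t. C (t * (1 - 2 * t)\<^sup>2)) has_real_derivative C' (x * (1 - 2 * x)\<^sup>2) * ((1 - 2 * x) * (1 - 6 * x))) (at x)" .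
    have 2: "(fhat C' has_real_derivative (1 - 2 * x)\<^sup>2 * C' (x * (1 - 2 * x)\<^sup>2)) (at x)"
      using fhat_deriv[of x] x xl by (simp add: lams)
    have "((\<lambda>t. 1 - 2 * t) has_real_derivative - 2) (at x)"
      by (rule derivative_eq_intros refl)+ simp
    from DERIV_chain2[OF fhat_deriv this]
    have "((\<lambda>t. fhat C' (1 - 2 * t)) has_real_derivative lam (1 - 2 * x) * C' ((1 - 2 * x) * lam (1 - 2 * x)) * - 2) (at x)"
      using x xl by simp
    also have "(1 - 2 * x) * lam (1 - 2 * x) = x * (1 - 2 * x)\<^sup>2"
      by (simp add: lams power2_eq_square)
    finally have 3: "((\<lambda>t. fhat C' (1 - 2 * t)) has_real_derivative x * (1 - 2 * x) * C' (x * (1 - 2 * x)\<^sup>2) * - 2) (at x)"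
      by (simp add: lams)
    have "(?\<phi> has_real_derivative C' (x * (1 - 2 * x)\<^sup>2) * ((1 - 2 * x) * (1 - 6 * x))
        - (1 - 2 * x)\<^sup>2 * C' (x * (1 - 2 * x)\<^sup>2) - 2 * (x * (1 - 2 * x) * C' (x * (1 - 2 * x)\<^sup>2) * - 2)) (at x)"
      by (intro DERIV_diff DERIV_cmult 1 2 3)
    also have "C' (x * (1 - 2 * x)\<^sup>2) * ((1 - 2 * x) * (1 - 6 * x))
        - (1 - 2 * x)\<^sup>2 * C' (x * (1 - 2 * x)\<^sup>2) - 2 * (x * (1 - 2 * x) * C' (x * (1 - 2 * x)\<^sup>2) * - 2) = 0"
      by algebra
    finally show "DERIV ?\<phi> x :> 0" .
  qed
  then show ?thesis by (simp add: gap_def fhat_0 power2_eq_square mult.assoc)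
qed

text \<open>On [l, r] the product t \<lambda>(t) has the constant value \<open>K\<close>, so the
  integrand of \<open>fhat\<close> is K C'(K)/t and integrates to a logarithm.\<close>

lemma fhat_mid:
  assumes "x \<in> {l_const..r_const}"
  defines "K \<equiv> l_const * r_const\<^sup>2"
  shows "fhat C' x = fhat C' l_const + K * C' K * (ln x - ln l_const)"
proof (cases "x = l_const")
  case False
  with assms have x: "l_const < x" by simp
  let ?\<phi> = "\<lambda>x. fhat C' x - K * C' K * ln x"
  have "?\<phi> x = ?\<phi> l_const"
  proof (rule DERIV_isconst_end[OF x])
    show "continuous_on {l_const..x} ?\<phi>"
      using assms l_const_pos r_const_bounds
      by (intro continuous_on_diff continuous_on_mult continuous_on_const continuous_on_ln
          continuous_on_id continuous_on_subset[OF continuous_fhat]) auto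
    fix y assume y: "l_const < y" "y < x"
    then have y': "0 < y" "y < 1" using assms l_const_pos r_const_bounds by auto
    have "lam y = K / y" using y assms by (simp add: lam_mid K_def)
    then have 1: "(fhat C' has_real_derivative K / y * C' K) (at y)"
      using fhat_deriv[OF y'] y' by simp
    have "(?\<phi> has_real_derivative K / y * C' K - K * C' K * (1 / y)) (at y)"
      using y' by (intro DERIV_diff DERIV_cmult 1 DERIV_ln_divide)
    then show "DERIV ?\<phi> y :> 0" by simp
  qed
  then show ?thesis by (simp add: algebra_simps)
qed simp

text \<open>On \<open>M_2\<close> the potentials are affine in the logarithms of the coordinates,
  whose sum is ln K, so the gap is constant there. The point (l, r, r) also lies on
  \<open>M_x\<close> and links this constant with that of the curves.\<close>

lemma gap_on_M_set:
  assumes "(x, y, z) \<in> M_set"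
  shows "gap x y z = C 0 - 2 * fhat C' 1"
proof -
  have curves: "gap x y z = C 0 - 2 * fhat C' 1" if "(x, y, z) \<in> M_x \<union> M_y \<union> M_z"
  proof -
    from that obtain t where "0 \<le> t" "t \<le> l_const"
      "(x, y, z) = (t, 1 - 2 * t, 1 - 2 * t) \<or> (x, y, z) = (1 - 2 * t, t, 1 - 2 * t) \<or> (x, y, z) = (1 - 2 * t, 1 - 2 * t, t)"
      by (auto simp: M_x_def M_y_def M_z_def)
    with gap_on_curve[of t] show ?thesis
      using gap_commute[of "1 - 2 * t" t] gap_commute[of "1 - 2 * t" "1 - 2 * t" t] by auto
  qed
  show ?thesis
  proof (cases "(x, y, z) \<in> M_2")
    case False
    with assms curves show ?thesis by (simp add: M_set_def)
  next
    case True
    define K where "K = l_const * r_const\<^sup>2"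
    have mid: "gap x y z = C K - (3 * fhat C' l_const + K * C' K * (ln K - 3 * ln l_const))"
      if "x \<in> {l_const..r_const}" "y \<in> {l_const..r_const}" "z \<in> {l_const..r_const}" "x * y * z = K" for x y z
    proof -
      have "0 < x" "0 < y" "0 < z" using that l_const_pos by auto
      then have "ln K = ln x + ln y + ln z" unfolding that(4)[symmetric] by (simp add: ln_mult)
      then show ?thesis
        using that fhat_mid[of x] fhat_mid[of y] fhat_mid[of z] by (simp add: gap_def algebra_simps K_def)
    qed
    have lr: "l_const \<le> r_const" using r_const_bounds l_const_less by simp
    have "gap x y z = gap l_const r_const r_const"
      using mid[of x y z] mid[of l_const r_const r_const] True lr
      by (simp add: M_2_def K_def power2_eq_square mult.assoc)
    also have "\<dots> = C 0 - 2 * fhat C' 1"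
      using gap_on_curve[of l_const] l_const_pos by (simp add: r_const_def)
    finally show ?thesis .
  qed
qed

lemma gap_ge:
  assumes "x \<in> {0..1}" "y \<in> {0..1}" "z \<in> {0..1}"
  shows "C 0 - 2 * fhat C' 1 \<le> gap x y z"
proof -
  obtain a b c where "(a, b, c) \<in> M_set" "\<And>x y z. (x, y, z) \<in> unit_cube \<Longrightarrow> gap a b c \<le> gap x y z"
    using gap_attains_minimum_in_M_set by blast
  then show ?thesis using gap_on_M_set[of a b c] assms by auto
qed

end

section \<open>Optimality\<close>

lemma integral_nonpos_if_nonpos_on_M_set:
  fixes S :: "real \<Rightarrow> real"
  assumes cont: "continuous_on {0..1} S"
    and nonpos: "\<And>x y z. (x, y, z) \<in> M_set \<Longrightarrow> S x + S y + S z \<le> 0"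
  shows "integral {0..1} S \<le> 0"
proof -
  define B where "B x = integral {0..x} S" for x
  have B_within: "(B has_real_derivative S x) (at x within {0..1})" if "x \<in> {0..1}" for x
    unfolding B_def[abs_def] using that by (rule integral_has_real_derivative[OF cont])
  have B_at: "(B has_real_derivative S x) (at x)" if "0 < x" "x < 1" for x
    using B_within[of x] at_within_Icc_at[of 0 x 1] that by simp
  have B_cont: "continuous_on {0..1} B" using B_within by (rule DERIV_continuous_on)
  \<comment> \<open>The derivative of B(t) - B(1 - 2t) is S(t) + 2 S(1 - 2t), a sum of S over a
    point of \<open>M_x\<close>. This treats [0, l] and [r, 1] together.\<close>
  have ends: "B l_const + B 1 - B r_const \<le> 0"
  proof -
    let ?\<Psi> = "\<lambda>t. B t - B (1 - 2 * t)"
    have "?\<Psi> l_const \<le> ?\<Psi> 0"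
    proof (rule DERIV_nonpos_imp_decreasing_open[where f = ?\<Psi> and a = 0 and b = l_const])
      show "0 \<le> l_const" using l_const_pos by simp
      fix t assume t: "0 < t" "t < l_const"
      then have t': "t < 1/9" using l_const_less by simp
      have "((\<lambda>t. 1 - 2 * t) has_real_derivative - 2) (at t)"
        by (rule derivative_eq_intros refl)+ simp
      from DERIV_chain2[OF B_at this]
      have "((\<lambda>t. B (1 - 2 * t)) has_real_derivative S (1 - 2 * t) * - 2) (at t)"
        using t t' by simp
      from DERIV_diff[OF B_at this] have "(?\<Psi> has_real_derivative S t - S (1 - 2 * t) * - 2) (at t)"
        using t t' by simp
      moreover have "S t + S (1 - 2 * t) + S (1 - 2 * t) \<le> 0"
        using t by (intro nonpos) (auto simp: M_set_def M_x_def)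
      ultimately show "\<exists>y. (?\<Psi> has_real_derivative y) (at t) \<and> y \<le> 0" by force
    next
      show "continuous_on {0..l_const} ?\<Psi>"
        by (intro continuous_on_diff continuous_on_compose2[OF B_cont] continuous_intros)
          (use l_const_less in auto)
    qed
    then show ?thesis by (simp add: B_def r_const_def)
  qed
  define k where "k = ln (r_const / l_const)"
  have rl: "0 < r_const / l_const" using l_const_pos r_const_bounds by simp
  have k: "k = 3 - 9 * l_const" "2 \<le> k"
    using l_const_eq l_const_less by (auto simp: k_def)
  have exp_k: "exp (- k) = l_const / r_const"
    using rl by (simp add: k_def exp_minus)
  \<comment> \<open>Logarithmic coordinates turn \<open>M_2\<close> into the simplex \<open>a + b + c = 1\<close>.\<close>
  define g where "g a = r_const * exp (- k * a)" for a
  have g_range: "g a \<in> {l_const..r_const}" if "a \<in> {0..1}" for a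
  proof -
    have "exp (- k) \<le> exp (- k * a)" "exp (- k * a) \<le> 1" using that k(2) by (auto simp: mult_left_le)
    then have "r_const * exp (- k) \<le> g a" "g a \<le> r_const * 1"
      unfolding g_def using r_const_bounds by (auto intro: mult_left_mono)
    then show ?thesis using r_const_bounds by (simp add: exp_k)
  qed
  have g_01: "g 0 = r_const" "g 1 = l_const" using exp_k r_const_bounds by (simp_all add: g_def)
  have g_cont: "continuous_on {0..1} g" unfolding g_def[abs_def] by (intro continuous_intros)
  have sub: "{l_const..r_const} \<subseteq> {0..1}" using l_const_pos r_const_bounds by auto
  interpret nonpos_on_simplex "\<lambda>a. S (g a)"
  proof
    show "continuous_on {0..1} (\<lambda>a. S (g a))"
      by (rule continuous_on_compose2[OF cont g_cont]) (use g_range sub in blast)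
    fix a b c :: real assume abc: "0 \<le> a" "0 \<le> b" "0 \<le> c" "a + b + c = 1"
    show "S (g a) + S (g b) + S (g c) \<le> 0"
    proof (rule nonpos)
      have "g a * g b * g c = r_const^3 * exp (- k * (a + b + c))"
        by (simp add: g_def power3_eq_cube algebra_simps flip: exp_add)
      also have "\<dots> = l_const * r_const\<^sup>2"
        using abc exp_k r_const_bounds by (simp add: power2_eq_square power3_eq_cube)
      finally show "(g a, g b, g c) \<in> M_set"
        using g_range[of a] g_range[of b] g_range[of c] abc by (simp add: M_set_def M_2_def)
    qed
  qed
  \<comment> \<open>The mean condition: after multiplication by r, both sides are 3 - 9 l because r
    - l = 1 - 3 l and r + 2 l = 1.\<close>
  have "3 * (1 - l_const / r_const) = (3 - 9 * l_const) * (1 + 2 * (l_const / r_const))"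
    using r_const_bounds by (simp add: divide_simps) (simp add: r_const_def algebra_simps)
  then have "3 * (1 - exp (- k)) = k * (1 + 2 * exp (- k))"
    by (simp only: exp_k) (simp only: k(1))
  then have nonpos_mid: "integral {0..1} (\<lambda>a. S (g a) * exp (- k * a)) \<le> 0"
    using k(2) by (intro integral_exp_nonpos)
  \<comment> \<open>The substitution s = g(a) converts the weighted integral into that of S over
    [l, r]. As g decreases, the orientation is reversed.\<close>
  have "((\<lambda>a. (- k * r_const) * (S (g a) * exp (- k * a))) has_integral (B (g 1) - B (g 0))) {0..1}"
  proof (rule fundamental_theorem_of_calculus)
    fix a :: real assume a: "a \<in> {0..1}"
    have "(B has_real_derivative S (g a)) (at (g a))"
      using g_range[OF a] l_const_pos r_const_bounds by (intro B_at) auto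
    moreover have "(g has_real_derivative - k * g a) (at a)"
      unfolding g_def[abs_def] by (rule derivative_eq_intros refl)+ simp
    ultimately have "((\<lambda>a. B (g a)) has_real_derivative S (g a) * (- k * g a)) (at a)"
      by (rule DERIV_chain2)
    then have "((\<lambda>a. B (g a)) has_real_derivative (- k * r_const) * (S (g a) * exp (- k * a))) (at a within {0..1})"
      by (rule has_field_derivative_at_within[THEN DERIV_cong]) (simp add: g_def mult_ac)
    then show "((\<lambda>a. B (g a)) has_vector_derivative (- k * r_const) * (S (g a) * exp (- k * a))) (at a within {0..1})"
      by (simp add: has_real_derivative_iff_has_vector_derivative)
  qed simp
  from integral_unique[OF this] have "B r_const - B l_const = k * r_const * integral {0..1} (\<lambda>a. S (g a) * exp (- k * a))"
    by (simp add: g_01)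
  also have "\<dots> \<le> 0"
    using nonpos_mid k(2) r_const_bounds by (intro mult_nonneg_nonpos) auto
  finally show ?thesis using ends by (simp add: B_def)
qed

section \<open>Continuous competitors and dual optimality\<close>

text \<open>Dual competitors are only integrable. Replacing them one after the other by conjugates makes
  them continuous without decreasing the dual value.\<close>

lemma continuous_conjugate:
  fixes f g h :: "real \<Rightarrow> real" and c :: "real \<times> real \<times> real \<Rightarrow> real"
  assumes cont: "continuous_on unit_cube c"
    and le: "\<And>x y z. x \<in> {0..1} \<Longrightarrow> y \<in> {0..1} \<Longrightarrow> z \<in> {0..1} \<Longrightarrow> f x + g y + h z \<le> c (x, y, z)"
  shows "\<exists>F. continuous_on {0..1} F \<and> (\<forall>x\<in>{0..1}. f x \<le> F x)
    \<and> (\<forall>x\<in>{0..1}. \<forall>y\<in>{0..1}. \<forall>z\<in>{0..1}. F x + g y + h z \<le> c (x, y, z))"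
proof -
  let ?d = "\<lambda>x (y, z). c (x, y, z) - g y - h z"
  \<comment> \<open>The largest function of the first variable admissible with g and h. The
    functions under the infimum have a common modulus of continuity in x, inherited from c, and F
    inherits it in turn. Admissibility of f bounds the infimum below.\<close>
  define F where "F x = (INF p\<in>{0..1}\<times>{0..1}. ?d x p)" for x
  have lower: "f x \<le> ?d x p" if "x \<in> {0..1}" "p \<in> {0..1}\<times>{0..1}" for x p
    using that le[of x "fst p" "snd p"] by (auto simp: algebra_simps)
  have bdd: "bdd_below (?d x ` ({0..1}\<times>{0..1}))" if "x \<in> {0..1}" for x
    using lower[OF that] by (intro bdd_belowI2)
  have F_le: "F x \<le> ?d x p" if "x \<in> {0..1}" "p \<in> {0..1}\<times>{0..1}" for x p
    unfolding F_def using that by (intro cINF_lower bdd)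
  have F_ge: "f x \<le> F x" if "x \<in> {0..1}" for x
    unfolding F_def using lower[OF that] by (intro cINF_greatest) auto
  have F_feasible: "F x + g y + h z \<le> c (x, y, z)" if "x \<in> {0..1}" "y \<in> {0..1}" "z \<in> {0..1}" for x y z
    using F_le[of x "(y, z)"] that by simp
  have F_near: "F x \<le> F x' + e"
    if x: "x \<in> {0..1}" "x' \<in> {0..1}"
      and e: "\<And>y z. y \<in> {0..1} \<Longrightarrow> z \<in> {0..1} \<Longrightarrow> c (x, y, z) \<le> c (x', y, z) + e" for x x' e
  proof -
    have "F x - e \<le> F x'"
      unfolding F_def[of x']
    proof (rule cINF_greatest)
      fix p :: "real \<times> real" assume p: "p \<in> {0..1}\<times>{0..1}"
      then show "F x - e \<le> ?d x' p"
        using F_le[OF x(1) p] e[of "fst p" "snd p"] by (auto simp: case_prod_beta)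
    qed auto
    then show ?thesis by simp
  qed
  have "uniformly_continuous_on unit_cube c"
    using cont by (rule compact_uniformly_continuous) (intro compact_Times compact_Icc)
  then have "continuous_on {0..1} F"
  proof (unfold continuous_on_iff, intro ballI allI impI)
    fix x e :: real assume x: "x \<in> {0..1}" and e: "0 < e" and uc: "uniformly_continuous_on unit_cube c"
    \<comment> \<open>The bound e/2 leaves room for the strict inequality, since infima preserve
      only weak ones.\<close>
    from uc e obtain d where d: "0 < d"
      "\<And>p q. p \<in> unit_cube \<Longrightarrow> q \<in> unit_cube \<Longrightarrow> dist q p < d \<Longrightarrow> dist (c q) (c p) < e / 2"
      unfolding uniformly_continuous_on_def by (metis half_gt_zero)
    show "\<exists>d>0. \<forall>x'\<in>{0..1}. dist x' x < d \<longrightarrow> dist (F x') (F x) < e"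
    proof (intro exI[of _ d] conjI ballI impI d(1))
      fix x' assume x': "x' \<in> {0..1}" "dist x' x < d"
      have near: "c (x', y, z) \<le> c (x, y, z) + e / 2 \<and> c (x, y, z) \<le> c (x', y, z) + e / 2"
        if "y \<in> {0..1}" "z \<in> {0..1}" for y z
      proof -
        have "dist (c (x', y, z)) (c (x, y, z)) < e / 2"
          using x x' that by (intro d(2)) (auto simp: dist_Pair_Pair)
        then show ?thesis unfolding dist_real_def by linarith
      qed
      have "F x' \<le> F x + e / 2"
        by (rule F_near) (use x x' near in blast)+
      moreover have "F x \<le> F x' + e / 2"
        by (rule F_near) (use x x' near in blast)+
      ultimately show "dist (F x') (F x) < e" using e by (simp add: dist_real_def abs_le_iff)
    qed
  qed
  with F_ge F_feasible show ?thesis by blast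
qed

lemma M_set_rotate: "(x, y, z) \<in> M_set \<Longrightarrow> (y, z, x) \<in> M_set"
proof -
  have "(x, y, z) \<in> M_x \<Longrightarrow> (y, z, x) \<in> M_z" "(x, y, z) \<in> M_y \<Longrightarrow> (y, z, x) \<in> M_x"
    "(x, y, z) \<in> M_z \<Longrightarrow> (y, z, x) \<in> M_y"
    unfolding M_x_def M_y_def M_z_def by blast+
  moreover have "(x, y, z) \<in> M_2 \<Longrightarrow> (y, z, x) \<in> M_2"
    by (simp add: M_2_def mult_ac)
  ultimately show "(x, y, z) \<in> M_set \<Longrightarrow> (y, z, x) \<in> M_set"
    unfolding M_set_def by blast
qed

lemma M_set_subset_cube: "M_set \<subseteq> unit_cube"
  using l_const_pos r_const_bounds l_const_less
  by (auto simp: M_set_def M_x_def M_y_def M_z_def M_2_def)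

lemma dual_value_continuous:
  assumes "continuous_on {0..1} f" "continuous_on {0..1} g" "continuous_on {0..1} h"
  shows "dual_value f g h = integral {0..1} (\<lambda>s. f s + g s + h s)"
proof -
  have "integral\<^sup>L (lebesgue_on {0..1}) \<phi> = integral {0..1} \<phi>" if "continuous_on {0..1} \<phi>" for \<phi> :: "real \<Rightarrow> real"
    using continuous_imp_integrable_real[OF that] by (intro lebesgue_integral_eq_integral) auto
  then show ?thesis
    using assms by (simp add: dual_value_def Henstock_Kurzweil_Integration.integral_add
        integrable_continuous_real continuous_on_add)
qed

lemma dual_value_mono:
  assumes "integrable (lebesgue_on {0..1}) f" "integrable (lebesgue_on {0..1}) g" "integrable (lebesgue_on {0..1}) h"
    and "integrable (lebesgue_on {0..1}) f'" "integrable (lebesgue_on {0..1}) g'" "integrable (lebesgue_on {0..1}) h'"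
    and "\<And>x. x \<in> {0..1} \<Longrightarrow> f x \<le> f' x" "\<And>x. x \<in> {0..1} \<Longrightarrow> g x \<le> g' x" "\<And>x. x \<in> {0..1} \<Longrightarrow> h x \<le> h' x"
  shows "dual_value f g h \<le> dual_value f' g' h'"
  unfolding dual_value_def using assms by (intro add_mono integral_mono) auto

text \<open>The dual value of continuous functions depends only on their pointwise sum. The
  difference \<open>?S\<close> of the competing sum and the given one satisfies the hypothesis of
  \<open>integral_nonpos_if_nonpos_on_M_set\<close>, so the competitor cannot have the larger
  value.\<close>

lemma dual_solutionI:
  fixes c :: "real \<times> real \<times> real \<Rightarrow> real"
  assumes cont: "continuous_on unit_cube c"
    and sym: "\<And>x y z. c (x, y, z) = c (y, x, z)" "\<And>x y z. c (x, y, z) = c (x, z, y)"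
    and fgh: "continuous_on {0..1} f" "continuous_on {0..1} g" "continuous_on {0..1} h"
    and le: "\<And>x y z. x \<in> {0..1} \<Longrightarrow> y \<in> {0..1} \<Longrightarrow> z \<in> {0..1} \<Longrightarrow> f x + g y + h z \<le> c (x, y, z)"
    and eq: "\<And>x y z. (x, y, z) \<in> M_set \<Longrightarrow> f x + g y + h z = c (x, y, z)"
  shows "dual_solution c f g h"
  unfolding dual_solution_def
proof (intro conjI allI impI)
  show "dual_feasible c f g h"
    unfolding dual_feasible_def using fgh le by (auto intro: continuous_imp_integrable_real)
  fix f' g' h' assume feas: "dual_feasible c f' g' h'"
  then have le': "f' x + g' y + h' z \<le> c (x, y, z)" if "x \<in> {0..1}" "y \<in> {0..1}" "z \<in> {0..1}" for x y z
    using that by (auto simp: dual_feasible_def)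
  from continuous_conjugate[OF cont le'] obtain F where
    F: "continuous_on {0..1} F \<and> (\<forall>x\<in>{0..1}. f' x \<le> F x)
      \<and> (\<forall>x\<in>{0..1}. \<forall>y\<in>{0..1}. \<forall>z\<in>{0..1}. F x + g' y + h' z \<le> c (x, y, z))" ..
  \<comment> \<open>Symmetry of c moves the function to be replaced into the first argument, as
    \<open>continuous_conjugate\<close> expects.\<close>
  have "g' x + F y + h' z \<le> c (x, y, z)" if "x \<in> {0..1}" "y \<in> {0..1}" "z \<in> {0..1}" for x y z
  proof -
    have "F y + g' x + h' z \<le> c (y, x, z)" using F that by blast
    then show ?thesis using sym(1)[of x y z] by simp
  qed
  from continuous_conjugate[OF cont this] obtain G where
    G: "continuous_on {0..1} G \<and> (\<forall>x\<in>{0..1}. g' x \<le> G x)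
      \<and> (\<forall>x\<in>{0..1}. \<forall>y\<in>{0..1}. \<forall>z\<in>{0..1}. G x + F y + h' z \<le> c (x, y, z))" ..
  have "h' x + G y + F z \<le> c (x, y, z)" if "x \<in> {0..1}" "y \<in> {0..1}" "z \<in> {0..1}" for x y z
  proof -
    have "G y + F z + h' x \<le> c (y, z, x)" using G that by blast
    then show ?thesis using sym(1)[of x y z] sym(2)[of y x z] by simp
  qed
  from continuous_conjugate[OF cont this] obtain H where
    H: "continuous_on {0..1} H \<and> (\<forall>x\<in>{0..1}. h' x \<le> H x)
      \<and> (\<forall>x\<in>{0..1}. \<forall>y\<in>{0..1}. \<forall>z\<in>{0..1}. H x + G y + F z \<le> c (x, y, z))" ..
  have conts: "continuous_on {0..1} F" "continuous_on {0..1} G" "continuous_on {0..1} H"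
    using F G H by simp_all
  have ints: "integrable (lebesgue_on {0..1}) f'" "integrable (lebesgue_on {0..1}) g'"
    "integrable (lebesgue_on {0..1}) h'"
    using feas unfolding dual_feasible_def by blast+
  have "dual_value f' g' h' \<le> dual_value F G H"
    by (rule dual_value_mono[OF ints conts[THEN continuous_imp_integrable_real]]) (use F G H in blast)+
  also have "\<dots> \<le> dual_value f g h"
  proof -
    let ?S = "\<lambda>s. (F s + G s + H s) - (f s + g s + h s)"
    have "integral {0..1} ?S \<le> 0"
    proof (rule integral_nonpos_if_nonpos_on_M_set)
      show "continuous_on {0..1} ?S" by (intro continuous_intros fgh conts)
      fix x y z assume M: "(x, y, z) \<in> M_set"
      have *: "F x + G y + H z \<le> f x + g y + h z" if "(x, y, z) \<in> M_set" for x y z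
      proof -
        have "x \<in> {0..1}" "y \<in> {0..1}" "z \<in> {0..1}" using that M_set_subset_cube by auto
        then have "H z + G y + F x \<le> c (z, y, x)" using H by blast
        also have "c (z, y, x) = c (x, y, z)" using sym(1)[of z y x] sym(2)[of y z x] sym(1)[of y x z] by simp
        finally show ?thesis using eq[OF that] by simp
      qed
      \<comment> \<open>Over the three cyclic shifts of a point of \<open>M_set\<close>, each of the
        functions meets each coordinate exactly once.\<close>
      show "?S x + ?S y + ?S z \<le> 0"
        using *[OF M] *[OF M_set_rotate[OF M]] *[OF M_set_rotate[OF M_set_rotate[OF M]]] by simp
    qed
    moreover have "integral {0..1} ?S = dual_value F G H - dual_value f g h"
      unfolding dual_value_continuous[OF conts] dual_value_continuous[OF fgh]
      by (intro Henstock_Kurzweil_Integration.integral_diff integrable_continuous_real continuous_intros fgh conts)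
    ultimately show ?thesis by simp
  qed
  finally show "dual_value f' g' h' \<le> dual_value f g h" .
qed

section \<open>Supports, marginals and primal optimality\<close>

lemma AE_measure_support:
  fixes \<mu> :: "'a::second_countable_topology measure"
  assumes sets: "\<And>U. open U \<Longrightarrow> U \<inter> space \<mu> \<in> sets \<mu>"
  shows "AE p in \<mu>. p \<in> measure_support \<mu>"
proof -
  obtain \<B> :: "'a set set" where \<B>: "countable \<B>" "topological_basis \<B>"
    using ex_countable_basis by metis
  \<comment> \<open>Every point of the space off the support has a basic neighbourhood of measure 0,
    and a countable basis contains only countably many of these.\<close>
  define \<N> where "\<N> = {B \<in> \<B>. emeasure \<mu> (B \<inter> space \<mu>) = 0}"
  have "(\<Union>B\<in>\<N>. B \<inter> space \<mu>) \<in> null_sets \<mu>"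
  proof (rule null_sets_UN')
    show "countable \<N>" using \<B>(1) by (auto simp: \<N>_def intro: countable_subset)
    show "B \<inter> space \<mu> \<in> null_sets \<mu>" if "B \<in> \<N>" for B
      using that sets topological_basis_open[OF \<B>(2)] by (auto simp: \<N>_def)
  qed
  moreover have "{p \<in> space \<mu>. p \<notin> measure_support \<mu>} \<subseteq> (\<Union>B\<in>\<N>. B \<inter> space \<mu>)"
  proof
    fix p assume "p \<in> {p \<in> space \<mu>. p \<notin> measure_support \<mu>}"
    then obtain U where p: "p \<in> space \<mu>" and U: "open U" "p \<in> U" "emeasure \<mu> (U \<inter> space \<mu>) = 0"
      by (auto simp: measure_support_def)
    obtain B where B: "B \<in> \<B>" "p \<in> B" "B \<subseteq> U"
      using topological_basisE[OF \<B>(2) U(1,2)] by metis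
    have "emeasure \<mu> (B \<inter> space \<mu>) \<le> emeasure \<mu> (U \<inter> space \<mu>)"
      using B by (intro emeasure_mono sets U(1)) auto
    then have "B \<in> \<N>" using B U by (simp add: \<N>_def)
    with B p show "p \<in> (\<Union>B\<in>\<N>. B \<inter> space \<mu>)" by blast
  qed
  ultimately show ?thesis by (rule AE_I')
qed

lemma integral_projection:
  fixes \<phi> :: "real \<Rightarrow> real" and pr :: "real \<times> real \<times> real \<Rightarrow> real"
  assumes sets: "sets \<mu> = sets (restrict_space borel unit_cube)"
    and distr: "distr \<mu> (restrict_space lborel {0..1}) pr = restrict_space lborel {0..1}"
    and pr: "pr \<in> borel_measurable borel" "pr \<in> unit_cube \<rightarrow> {0..1}"
    and cont: "continuous_on {0..1} \<phi>"
  shows "integrable \<mu> (\<lambda>p. \<phi> (pr p))" "(\<integral>p. \<phi> (pr p) \<partial>\<mu>) = integral {0..1} \<phi>"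
proof -
  let ?I = "restrict_space lborel {0..1::real}"
  have space: "space \<mu> = unit_cube"
    using sets_eq_imp_space_eq[OF sets] by (simp add: space_restrict_space)
  have pr_meas: "pr \<in> measurable \<mu> ?I"
  proof (rule measurable_restrict_space2)
    show "pr \<in> space \<mu> \<rightarrow> {0..1}" using pr(2) space by simp
    show "pr \<in> measurable \<mu> lborel"
      using measurable_restrict_space1[OF pr(1), of unit_cube]
      by (simp add: measurable_cong_sets[OF sets refl])
  qed
  have \<phi>_meas: "\<phi> \<in> borel_measurable ?I"
    using borel_measurable_continuous_on_restrict[OF cont]
    by (simp cong: measurable_cong_sets sets_restrict_space_cong)
  have set_int: "set_integrable lborel {0..1} \<phi>"
    using cont by (rule borel_integrable_atLeastAtMost')
  then have int: "integrable ?I \<phi>"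
    by (simp add: integrable_restrict_space set_integrable_def)
  have "integral\<^sup>L ?I \<phi> = integral {0..1} \<phi>"
    using set_borel_integral_eq_integral(2)[OF set_int]
    by (simp add: integral_restrict_space set_lebesgue_integral_def)
  then show "(\<integral>p. \<phi> (pr p) \<partial>\<mu>) = integral {0..1} \<phi>"
    using integral_distr[OF pr_meas \<phi>_meas] distr by simp
  show "integrable \<mu> (\<lambda>p. \<phi> (pr p))"
    using integrable_distr_eq[OF pr_meas \<phi>_meas] distr int by simp
qed

lemma integral_stochastic_3_1:
  fixes f g h :: "real \<Rightarrow> real"
  assumes "stochastic_3_1 \<mu>"
    and "continuous_on {0..1} f" "continuous_on {0..1} g" "continuous_on {0..1} h"
  shows "integrable \<mu> (\<lambda>(x, y, z). f x + g y + h z)"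
    "(\<integral>p. (case p of (x, y, z) \<Rightarrow> f x + g y + h z) \<partial>\<mu>) = integral {0..1} f + integral {0..1} g + integral {0..1} h"
proof -
  have \<mu>: "sets \<mu> = sets (restrict_space borel unit_cube)"
    "distr \<mu> (restrict_space lborel {0..1}) (\<lambda>(x, y, z). x) = restrict_space lborel {0..1}"
    "distr \<mu> (restrict_space lborel {0..1}) (\<lambda>(x, y, z). y) = restrict_space lborel {0..1}"
    "distr \<mu> (restrict_space lborel {0..1}) (\<lambda>(x, y, z). z) = restrict_space lborel {0..1}"
    using assms(1) by (simp_all add: stochastic_3_1_def Let_def)
  have m: "(\<lambda>(x, y, z). x :: real) \<in> borel_measurable (borel :: (real \<times> real \<times> real) measure)"
    "(\<lambda>(x, y, z). y :: real) \<in> borel_measurable (borel :: (real \<times> real \<times> real) measure)"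
    "(\<lambda>(x, y, z). z :: real) \<in> borel_measurable (borel :: (real \<times> real \<times> real) measure)"
    unfolding case_prod_beta by (intro borel_measurable_continuous_onI continuous_intros)+
  note 1 = integral_projection[OF \<mu>(1,2) m(1) _ assms(2)]
  note 2 = integral_projection[OF \<mu>(1,3) m(2) _ assms(3)]
  note 3 = integral_projection[OF \<mu>(1,4) m(3) _ assms(4)]
  have split: "(\<lambda>(x, y, z). f x + g y + h z)
      = (\<lambda>p. f ((\<lambda>(x, y, z). x) p) + g ((\<lambda>(x, y, z). y) p) + h ((\<lambda>(x, y, z). z) p))"
    by (auto simp: fun_eq_iff)
  show "integrable \<mu> (\<lambda>(x, y, z). f x + g y + h z)"
    unfolding split by (intro Bochner_Integration.integrable_add 1(1) 2(1) 3(1)) auto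
  have "(\<integral>p. f ((\<lambda>(x, y, z). x) p) + g ((\<lambda>(x, y, z). y) p) + h ((\<lambda>(x, y, z). z) p) \<partial>\<mu>)
     = (\<integral>p. f ((\<lambda>(x, y, z). x) p) \<partial>\<mu>) + (\<integral>p. g ((\<lambda>(x, y, z). y) p) \<partial>\<mu>) + (\<integral>p. h ((\<lambda>(x, y, z). z) p) \<partial>\<mu>)"
    by (subst Bochner_Integration.integral_add | intro Bochner_Integration.integrable_add 1(1) 2(1) 3(1) | force)+
  also have "\<dots> = integral {0..1} f + integral {0..1} g + integral {0..1} h"
    by (intro arg_cong2[where f = "(+)"] 1(2) 2(2) 3(2)) auto
  finally show "(\<integral>p. (case p of (x, y, z) \<Rightarrow> f x + g y + h z) \<partial>\<mu>) = integral {0..1} f + integral {0..1} g + integral {0..1} h"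
    unfolding split .
qed

text \<open>Complementary slackness: the integral of f(x) + g(y) + h(z) depends only on the
  marginals, hence agrees for all \<open>(3,1)\<close>-stochastic measures. It equals the cost of
  \<pi>, whose mass lies on its support, and is a lower bound for every other cost.\<close>

lemma primal_solutionI:
  fixes c :: "real \<times> real \<times> real \<Rightarrow> real"
  assumes cont: "continuous_on unit_cube c"
    and fgh: "continuous_on {0..1} f" "continuous_on {0..1} g" "continuous_on {0..1} h"
    and le: "\<And>x y z. x \<in> {0..1} \<Longrightarrow> y \<in> {0..1} \<Longrightarrow> z \<in> {0..1} \<Longrightarrow> f x + g y + h z \<le> c (x, y, z)"
    and eq: "\<And>x y z. (x, y, z) \<in> M \<Longrightarrow> f x + g y + h z = c (x, y, z)"
    and stoch: "stochastic_3_1 \<pi>" and supp: "measure_support \<pi> \<subseteq> M"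
  shows "primal_solution c \<pi>"
proof -
  let ?s = "\<lambda>(x, y, z). f x + g y + h z"
  have sets: "sets \<nu> = sets (restrict_space borel unit_cube)" "prob_space \<nu>" if "stochastic_3_1 \<nu>" for \<nu>
    using that by (simp_all add: stochastic_3_1_def)
  have space: "space \<nu> = unit_cube" if "stochastic_3_1 \<nu>" for \<nu>
    using sets_eq_imp_space_eq[OF sets(1)[OF that]] by (simp add: space_restrict_space)
  have meas: "c \<in> borel_measurable \<nu>" if "stochastic_3_1 \<nu>" for \<nu>
    using borel_measurable_continuous_on_restrict[OF cont]
    by (simp add: measurable_cong_sets[OF sets(1)[OF that] refl])
  have int: "integrable \<nu> c" if "stochastic_3_1 \<nu>" for \<nu>
  proof -
    interpret prob_space \<nu> by (rule sets(2)[OF that])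
    have "bounded (c ` unit_cube)"
      by (intro compact_imp_bounded compact_continuous_image cont compact_Times compact_Icc)
    then obtain B where "\<And>p. p \<in> unit_cube \<Longrightarrow> norm (c p) \<le> B"
      unfolding bounded_iff by blast
    then show ?thesis
      using meas[OF that] space[OF that] by (intro integrable_const_bound[of _ B]) auto
  qed
  have "integral\<^sup>L \<pi> c \<le> integral\<^sup>L \<nu> c" if "stochastic_3_1 \<nu>" for \<nu>
  proof -
    have "AE p in \<pi>. p \<in> measure_support \<pi>"
    proof (rule AE_measure_support)
      fix U :: "(real \<times> real \<times> real) set" assume "open U"
      then show "U \<inter> space \<pi> \<in> sets \<pi>"
        unfolding sets(1)[OF stoch] space[OF stoch] sets_restrict_space
        by (intro image_eqI[of _ _ U]) auto
    qed
    then have "AE p in \<pi>. c p = ?s p"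
      by eventually_elim (use supp eq in auto)
    then have "integral\<^sup>L \<pi> c = integral\<^sup>L \<pi> ?s"
      using meas[OF stoch] borel_measurable_integrable[OF integral_stochastic_3_1(1)[OF stoch fgh]]
      by (intro integral_cong_AE) auto
    also have "\<dots> = integral\<^sup>L \<nu> ?s"
      unfolding integral_stochastic_3_1(2)[OF stoch fgh] integral_stochastic_3_1(2)[OF that fgh] ..
    also have "\<dots> \<le> integral\<^sup>L \<nu> c"
      using integral_stochastic_3_1(1)[OF that fgh] int[OF that] by (rule integral_mono) (use le space[OF that] in auto)
    finally show ?thesis .
  qed
  with stoch int show ?thesis by (simp add: primal_solution_def)
qed

theorem theorem1p2:
  fixes C C' :: "real \<Rightarrow> real" and Cx Cy Cz :: real
  assumes C_deriv: "\<And>t. t \<in> {0..1} \<Longrightarrow> (C has_real_derivative C' t) (at t within {0..1})"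
    and C'_cont: "continuous_on {0..1} C'"
    and strict_incr: "strict_mono_on {0..1} (\<lambda>t. t * C' t)"
    and sum_eq: "Cx + Cy + Cz = C 0 - 2 * integral {0..1} (\<lambda>t. lam t * C' (t * lam t))"
  shows "(\<forall>x\<in>{0..1}. \<forall>y\<in>{0..1}. \<forall>z\<in>{0..1}.
            (fhat C' x + Cx) + (fhat C' y + Cy) + (fhat C' z + Cz) \<le> product_cost C (x, y, z))
       \<and> (\<forall>(x, y, z)\<in>M_set.
            (fhat C' x + Cx) + (fhat C' y + Cy) + (fhat C' z + Cz) = product_cost C (x, y, z))
       \<and> (\<forall>\<pi>. stochastic_3_1 \<pi> \<and> measure_support \<pi> \<subseteq> M_set
            \<longrightarrow> primal_solution (product_cost C) \<pi>)
       \<and> dual_solution (product_cost C)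
            (\<lambda>s. fhat C' s + Cx) (\<lambda>s. fhat C' s + Cy) (\<lambda>s. fhat C' s + Cz)"
proof -
  interpret increasing_cost C C'
    using C_deriv C'_cont strict_incr by unfold_locales
  have sum: "Cx + Cy + Cz = C 0 - 2 * fhat C' 1" using sum_eq by (simp add: fhat_def)
  have le: "(fhat C' x + Cx) + (fhat C' y + Cy) + (fhat C' z + Cz) \<le> product_cost C (x, y, z)"
    if "x \<in> {0..1}" "y \<in> {0..1}" "z \<in> {0..1}" for x y z
    using gap_ge[OF that] sum by (simp add: gap_def product_cost_def)
  have eq: "(fhat C' x + Cx) + (fhat C' y + Cy) + (fhat C' z + Cz) = product_cost C (x, y, z)"
    if "(x, y, z) \<in> M_set" for x y z
    using gap_on_M_set[OF that] sum by (simp add: gap_def product_cost_def)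
  have cont: "continuous_on unit_cube (product_cost C)"
    unfolding product_cost_def case_prod_beta
    by (intro continuous_on_compose2[OF C_cont] continuous_intros) (auto intro!: mult_le_one)
  have fgh: "continuous_on {0..1} (\<lambda>s. fhat C' s + d)" for d
    by (intro continuous_intros continuous_fhat)
  have primal: "primal_solution (product_cost C) \<pi>"
    if "stochastic_3_1 \<pi> \<and> measure_support \<pi> \<subseteq> M_set" for \<pi>
    by (rule primal_solutionI[OF cont fgh fgh fgh le eq conjunct1[OF that] conjunct2[OF that]])
  have dual: "dual_solution (product_cost C) (\<lambda>s. fhat C' s + Cx) (\<lambda>s. fhat C' s + Cy) (\<lambda>s. fhat C' s + Cz)"
    by (rule dual_solutionI[OF cont _ _ fgh fgh fgh le eq]) (simp_all add: product_cost_def mult_ac)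
  show ?thesis
  proof (intro conjI ballI allI impI)
    fix p assume "p \<in> M_set"
    then show "case p of (x, y, z) \<Rightarrow>
        (fhat C' x + Cx) + (fhat C' y + Cy) + (fhat C' z + Cz) = product_cost C (x, y, z)"
      by (cases p rule: prod_cases3) (simp only: prod.case eq)
  qed (fact le primal dual)+
qed

end
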